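(* The recognition problems for unit grid intersection graphs and for USEG graphs are in NP; more precisely, membership of an $n$-vertex graph in either class admits a certificate of size $O(n\log n)$ that can be verified in polynomial time.
   Context: A grid intersection representation of a bipartite graph $G$ with bipartition $(H,V)$ assigns to each vertex of $H$ a horizontal closed line segment and to each vertex of $V$ a vertical closed line segment in the plane, such that no two horizontal segments intersect, no two vertical segments intersect, and for $u\in H$, $v\in V$ the segments intersect if and only if $uv\in E(G)$. $G$ is a unit grid intersection graph if it has such a representation with all segments of length $1$, and a USEG graph if it has such a representation in which all segments of one of the two orientations have length $1$. *)

theory Defs
  imports
    "HOL-Analysis.Analysis"
    "HOL-Library.Landau_Symbols"
    "HOL-Computational_Algebra.Polynomial"
    "Graph_Theory.Pair_Digraph"
begin

section \<open>Grid intersection representations\<close>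

text \<open>
  A finite simple graph is a \<^locale>\<open>pair_graph\<close>: the edge \<open>uv\<close> is represented by the two
  arcs \<open>(u, v)\<close> and \<open>(v, u)\<close>.
\<close>

definition bipartition :: "'a pair_pre_digraph \<Rightarrow> 'a set \<Rightarrow> 'a set \<Rightarrow> bool" where
  "bipartition G H V \<longleftrightarrow>
     H \<union> V = pverts G \<and> H \<inter> V = {} \<and>
     (\<forall>(u, v) \<in> parcs G. (u \<in> H \<and> v \<in> V) \<or> (u \<in> V \<and> v \<in> H))"

definition horizontal_segment :: "real \<Rightarrow> (real \<times> real) set \<Rightarrow> bool" where
  "horizontal_segment l S \<longleftrightarrow> l > 0 \<and> (\<exists>x y. S = closed_segment (x, y) (x + l, y))"

definition vertical_segment :: "real \<Rightarrow> (real \<times> real) set \<Rightarrow> bool" where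
  "vertical_segment l S \<longleftrightarrow> l > 0 \<and> (\<exists>x y. S = closed_segment (x, y) (x, y + l))"

definition grid_intersection_rep ::
    "'a pair_pre_digraph \<Rightarrow> 'a set \<Rightarrow> 'a set \<Rightarrow> ('a \<Rightarrow> (real \<times> real) set) \<Rightarrow> bool" where
  "grid_intersection_rep G H V S \<longleftrightarrow>
     (\<forall>u\<in>H. \<exists>l. horizontal_segment l (S u)) \<and>
     (\<forall>v\<in>V. \<exists>l. vertical_segment l (S v)) \<and>
     (\<forall>u\<in>H. \<forall>u'\<in>H. u \<noteq> u' \<longrightarrow> S u \<inter> S u' = {}) \<and>
     (\<forall>v\<in>V. \<forall>v'\<in>V. v \<noteq> v' \<longrightarrow> S v \<inter> S v' = {}) \<and>
     (\<forall>u\<in>H. \<forall>v\<in>V. S u \<inter> S v \<noteq> {} \<longleftrightarrow> (u, v) \<in> parcs G)"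

definition unit_grid_intersection_graph :: "'a pair_pre_digraph \<Rightarrow> bool" where
  "unit_grid_intersection_graph G \<longleftrightarrow>
     (\<exists>H V S. bipartition G H V \<and> grid_intersection_rep G H V S \<and>
        (\<forall>u\<in>H. horizontal_segment 1 (S u)) \<and> (\<forall>v\<in>V. vertical_segment 1 (S v)))"

definition USEG_graph :: "'a pair_pre_digraph \<Rightarrow> bool" where
  "USEG_graph G \<longleftrightarrow>
     (\<exists>H V S. bipartition G H V \<and> grid_intersection_rep G H V S \<and>
        ((\<forall>u\<in>H. horizontal_segment 1 (S u)) \<or> (\<forall>v\<in>V. vertical_segment 1 (S v))))"


section \<open>Polynomial-time computation\<close>

text \<open>
  The machine model is the random access machine with indirect addressing whose only arithmetic
  operations are addition and subtraction, programmed in structured form.  Each elementary step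
  costs one time unit.  Since one step lengthens the longest register content by at most one bit,
  this model is polynomially equivalent to the multi-tape Turing machine.

  Registers hold natural numbers (so subtraction is truncated).  A program reads two read-only
  bit strings, an instance \<open>x\<close> and a certificate \<open>c\<close>; reading past the end of a string yields 2.
\<close>

datatype com =
    Skip
  | Const nat nat          \<comment> \<open>\<open>R[i] := k\<close>\<close>
  | Add nat nat nat        \<comment> \<open>\<open>R[i] := R[j] + R[k]\<close>\<close>
  | Sub nat nat nat        \<comment> \<open>\<open>R[i] := R[j] - R[k]\<close>\<close>
  | Load nat nat           \<comment> \<open>\<open>R[i] := R[R[j]]\<close>\<close>
  | Store nat nat          \<comment> \<open>\<open>R[R[i]] := R[j]\<close>\<close>
  | Read_Instance nat nat  \<comment> \<open>\<open>R[i] := x[R[j]]\<close>\<close>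
  | Read_Cert nat nat      \<comment> \<open>\<open>R[i] := c[R[j]]\<close>\<close>
  | Seq com com
  | If nat com com         \<comment> \<open>branch on \<open>R[i] > 0\<close>\<close>
  | While nat com          \<comment> \<open>loop as long as \<open>R[i] > 0\<close>\<close>

definition read_bit :: "bool list \<Rightarrow> nat \<Rightarrow> nat" where
  "read_bit w i = (if i < length w then of_bool (w ! i) else 2)"

text \<open>\<open>exec x c P s t s'\<close>: started in state \<open>s\<close>, \<open>P\<close> halts after \<open>t\<close> steps in state \<open>s'\<close>.\<close>

inductive exec ::
    "bool list \<Rightarrow> bool list \<Rightarrow> com \<Rightarrow> (nat \<Rightarrow> nat) \<Rightarrow> nat \<Rightarrow> (nat \<Rightarrow> nat) \<Rightarrow> bool"
  for x c :: "bool list" where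
  Skip: "exec x c Skip s 1 s"
| Const: "exec x c (Const i k) s 1 (s(i := k))"
| Add: "exec x c (Add i j k) s 1 (s(i := s j + s k))"
| Sub: "exec x c (Sub i j k) s 1 (s(i := s j - s k))"
| Load: "exec x c (Load i j) s 1 (s(i := s (s j)))"
| Store: "exec x c (Store i j) s 1 (s(s i := s j))"
| Read_Instance: "exec x c (Read_Instance i j) s 1 (s(i := read_bit x (s j)))"
| Read_Cert: "exec x c (Read_Cert i j) s 1 (s(i := read_bit c (s j)))"
| Seq: "exec x c P s t s' \<Longrightarrow> exec x c Q s' t' s'' \<Longrightarrow> exec x c (Seq P Q) s (t + t') s''"
| IfTrue: "s i > 0 \<Longrightarrow> exec x c P s t s' \<Longrightarrow> exec x c (If i P Q) s (Suc t) s'"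
| IfFalse: "s i = 0 \<Longrightarrow> exec x c Q s t s' \<Longrightarrow> exec x c (If i P Q) s (Suc t) s'"
| WhileFalse: "s i = 0 \<Longrightarrow> exec x c (While i P) s 1 s"
| WhileTrue: "s i > 0 \<Longrightarrow> exec x c P s t s' \<Longrightarrow> exec x c (While i P) s' t' s'' \<Longrightarrow>
    exec x c (While i P) s (Suc (t + t')) s''"

inductive_cases exec_SkipE: "exec x c Skip s t s'"
inductive_cases exec_ConstE: "exec x c (Const i k) s t s'"
inductive_cases exec_AddE: "exec x c (Add i j k) s t s'"
inductive_cases exec_SubE: "exec x c (Sub i j k) s t s'"
inductive_cases exec_LoadE: "exec x c (Load i j) s t s'"
inductive_cases exec_StoreE: "exec x c (Store i j) s t s'"
inductive_cases exec_Read_InstanceE: "exec x c (Read_Instance i j) s t s'"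
inductive_cases exec_Read_CertE: "exec x c (Read_Cert i j) s t s'"
inductive_cases exec_SeqE: "exec x c (Seq P Q) s t s'"
inductive_cases exec_IfE: "exec x c (If i P Q) s t s'"
inductive_cases exec_WhileE: "exec x c (While i P) s t s'"

lemma exec_deterministic:
  "exec x c P s t s' \<Longrightarrow> exec x c P s u s'' \<Longrightarrow> u = t \<and> s'' = s'"
proof (induction arbitrary: u s'' rule: exec.induct)
  case (Skip s) then show ?case by (auto elim: exec_SkipE)
next
  case (Const i k s) then show ?case by (auto elim: exec_ConstE)
next
  case (Add i j k s) then show ?case by (auto elim: exec_AddE)
next
  case (Sub i j k s) then show ?case by (auto elim: exec_SubE)
next
  case (Load i j s) then show ?case by (auto elim: exec_LoadE)
next
  case (Store i j s) then show ?case by (auto elim: exec_StoreE)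
next
  case (Read_Instance i j s) then show ?case by (auto elim: exec_Read_InstanceE)
next
  case (Read_Cert i j s) then show ?case by (auto elim: exec_Read_CertE)
next
  case (Seq P s t s' Q t' s2)
  from Seq.prems obtain t1 s1 t2 where
    e: "exec x c P s t1 s1" "exec x c Q s1 t2 s''" "u = t1 + t2" by (rule exec_SeqE)
  from Seq.IH(1)[OF e(1)] have "t1 = t" "s1 = s'" by auto
  with Seq.IH(2)[of t2 s''] e show ?case by simp
next
  case (IfTrue s i P t s' Q)
  from IfTrue.prems show ?case
  proof (rule exec_IfE)
    fix t1 assume e: "u = Suc t1" "exec x c P s t1 s''"
    from IfTrue.IH[OF e(2)] e(1) show ?case by simp
  next
    assume "s i = 0" with IfTrue.hyps show ?case by simp
  qed
next
  case (IfFalse s i Q t s' P)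
  from IfFalse.prems show ?case
  proof (rule exec_IfE)
    assume "0 < s i" with IfFalse.hyps show ?case by simp
  next
    fix t1 assume e: "u = Suc t1" "exec x c Q s t1 s''"
    from IfFalse.IH[OF e(2)] e(1) show ?case by simp
  qed
next
  case (WhileFalse s i P)
  from WhileFalse.prems show ?case
  proof (rule exec_WhileE)
    assume "0 < s i" with WhileFalse.hyps show ?case by simp
  qed simp
next
  case (WhileTrue s i P t s' t' s2)
  from WhileTrue.prems show ?case
  proof (rule exec_WhileE)
    assume "s i = 0" with WhileTrue.hyps show ?case by simp
  next
    fix t1 s1 t2
    assume e: "u = Suc (t1 + t2)" "exec x c P s t1 s1" "exec x c (While i P) s1 t2 s''"
    from WhileTrue.IH(1)[OF e(2)] have "t1 = t" "s1 = s'" by auto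
    with WhileTrue.IH(2)[of t2 s''] e show ?case by simp
  qed
qed

text \<open>All registers are initially 0; a program accepts by halting with 1 in register 0.\<close>

definition accepts :: "com \<Rightarrow> bool list \<Rightarrow> bool list \<Rightarrow> bool" where
  "accepts P x c \<longleftrightarrow> (\<exists>t s. exec x c P (\<lambda>_. 0) t s \<and> s 0 = 1)"

definition polynomial_time :: "com \<Rightarrow> bool" where
  "polynomial_time P \<longleftrightarrow>
     (\<exists>p :: nat poly. \<forall>x c. \<exists>t s. exec x c P (\<lambda>_. 0) t s \<and> t \<le> poly p (length x + length c))"

definition NP :: "bool list set set" where
  "NP = {L. \<exists>P. \<exists>q :: nat poly. polynomial_time P \<and>
          (\<forall>x. x \<in> L \<longleftrightarrow> (\<exists>c. length c \<le> poly q (length x) \<and> accepts P x c))}"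


section \<open>Graph classes as decision problems\<close>

text \<open>Graphs on the vertex set \<open>{0, \<dots>, n - 1}\<close> are given by their adjacency matrix, row by row.\<close>

definition adjacency_code :: "nat pair_pre_digraph \<Rightarrow> bool list" where
  "adjacency_code G =
     (let n = card (pverts G) in concat (map (\<lambda>i. map (\<lambda>j. (i, j) \<in> parcs G) [0..<n]) [0..<n]))"

definition recognition_problem :: "(nat pair_pre_digraph \<Rightarrow> bool) \<Rightarrow> bool list set" where
  "recognition_problem K =
     {adjacency_code G | G. pair_graph G \<and> pverts G = {..<card (pverts G)} \<and> K G}"

text \<open>
  \<open>certificate_verifier P K b\<close>: \<open>P\<close> runs in polynomial time, accepts for every \<open>n\<close>-vertex member of
  \<open>K\<close> some certificate of at most \<open>b n\<close> bits, and accepts no certificate at all for a non-member.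
\<close>

definition certificate_verifier ::
    "com \<Rightarrow> (nat pair_pre_digraph \<Rightarrow> bool) \<Rightarrow> (nat \<Rightarrow> nat) \<Rightarrow> bool" where
  "certificate_verifier P K b \<longleftrightarrow>
     polynomial_time P \<and>
     (\<forall>n G. pair_graph G \<and> pverts G = {..<n} \<longrightarrow>
        (K G \<longrightarrow> (\<exists>c. length c \<le> b n \<and> accepts P (adjacency_code G) c)) \<and>
        (\<not> K G \<longrightarrow> (\<forall>c. \<not> accepts P (adjacency_code G) c)))"

end

theory Submission
  imports Defs "HOL-Library.Discrete_Functions"
begin

text \<open>
  The certificate consists of integer coordinates of the segments, with \<open>n\<close> as the unit of length.
  Only comparisons of the forms \<open>x \<le> y\<close> and \<open>x \<le> y + 1\<close> between coordinates matter. They survive if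
  fractional parts are replaced by their ranks, a number below \<open>n\<close>, and gaps between integer parts are
  closed up to length 2; coordinates that are merely compared are replaced by their ranks. So
  \<open>O(n\<^sup>2)\<close> bounds the coordinates, and each of them takes \<open>O(log n)\<close> bits. By reflection, the
  segments of unit length of a USEG graph may be taken to be the horizontal ones. The verifier compares
  all pairs of vertices; it is never written out, since its existence follows from closure properties
  of the functions computable in polynomial time, such as iteration with a polynomial bound.
\<close>

section \<open>Functions computable in polynomial time\<close>

text \<open>Gaps may be cut to 2 because the tests \<open>x \<le> y\<close> and
  \<open>x \<le> y + 1\<close> on integers only tell whether \<open>x - y\<close> is at most 0,
  equal to 1, or at least 2. With \<open>n\<close> as the unit there is room for \<open>n\<close>
  fractional ranks inside each unit, and adding \<open>n\<close> to a coordinate moves its integer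
  part and keeps its rank, just as adding 1 does for a real number. Soundness needs no bound on the
  coordinates: any natural numbers that pass the tests become a representation after division by
  \<open>n\<close>, so the certificate is read as it comes and its format is never checked. On the
  machine side the obstacle is that there is no multiplication, and that repeated addition can make
  register contents exponentially large.\<close>

definition poly_bounded :: "(nat \<Rightarrow> nat) \<Rightarrow> bool" where
  "poly_bounded T \<longleftrightarrow> (\<exists>p :: nat poly. \<forall>N. T N \<le> poly p N)"

lemma poly_bounded_const: "poly_bounded (\<lambda>_. k)"
  unfolding poly_bounded_def by (rule exI[of _ "[:k:]"]) simp

lemma poly_bounded_id: "poly_bounded (\<lambda>N. N)"
  unfolding poly_bounded_def by (rule exI[of _ "[:0, 1:]"]) simp

lemma poly_bounded_add:
  assumes "poly_bounded S" "poly_bounded T"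
  shows "poly_bounded (\<lambda>N. S N + T N)"
proof -
  obtain p q :: "nat poly" where "\<forall>N. S N \<le> poly p N" "\<forall>N. T N \<le> poly q N"
    using assms unfolding poly_bounded_def by blast
  then have "\<forall>N. S N + T N \<le> poly (p + q) N"
    by (simp add: add_mono)
  then show ?thesis
    unfolding poly_bounded_def by blast
qed

lemma poly_bounded_mult:
  assumes "poly_bounded S" "poly_bounded T"
  shows "poly_bounded (\<lambda>N. S N * T N)"
proof -
  obtain p q :: "nat poly" where "\<forall>N. S N \<le> poly p N" "\<forall>N. T N \<le> poly q N"
    using assms unfolding poly_bounded_def by blast
  then have "\<forall>N. S N * T N \<le> poly (p * q) N"
    by (simp add: mult_mono)
  then show ?thesis
    unfolding poly_bounded_def by blast
qed

lemmas poly_bounded_intros =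
  poly_bounded_const poly_bounded_id poly_bounded_add poly_bounded_mult

section \<open>Time-bounded total correctness of programs\<close>

definition runs ::
    "bool list \<Rightarrow> bool list \<Rightarrow> com \<Rightarrow> (nat \<Rightarrow> nat) \<Rightarrow> nat \<Rightarrow> ((nat \<Rightarrow> nat) \<Rightarrow> bool) \<Rightarrow> bool" where
  "runs x c C s T Q \<longleftrightarrow> (\<exists>t s'. exec x c C s t s' \<and> t \<le> T \<and> Q s')"

lemma runs_mono:
  assumes "runs x c C s T Q" "\<And>s'. Q s' \<Longrightarrow> Q' s'" "T \<le> T'"
  shows "runs x c C s T' Q'"
  using assms unfolding runs_def by (meson le_trans)

lemma runs_basic:
  "Q (s(i := k)) \<Longrightarrow> runs x c (Const i k) s 1 Q"
  "Q (s(i := s j + s l)) \<Longrightarrow> runs x c (Add i j l) s 1 Q"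
  "Q (s(i := s j - s l)) \<Longrightarrow> runs x c (Sub i j l) s 1 Q"
  "Q (s(i := read_bit x (s j))) \<Longrightarrow> runs x c (Read_Instance i j) s 1 Q"
  "Q (s(i := read_bit c (s j))) \<Longrightarrow> runs x c (Read_Cert i j) s 1 Q"
  unfolding runs_def by (meson exec.intros order_refl)+

lemma runs_Seq:
  assumes "runs x c C s S (\<lambda>s'. runs x c D s' T Q)"
  shows "runs x c (Seq C D) s (S + T) Q"
proof -
  from assms obtain t s1 u s2 where
    "exec x c C s t s1" "t \<le> S" "exec x c D s1 u s2" "u \<le> T" "Q s2"
    unfolding runs_def by blast
  then show ?thesis
    unfolding runs_def by (meson exec.Seq add_mono)
qed

text \<open>The index of \<open>I\<close> is the number of rounds still to come, so it serves as
  variant and as clock at once: each round pays \<open>T\<close> plus one for the test, and the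
  final failing test pays the last 1.\<close>

lemma runs_While:
  assumes exit: "\<And>s. I 0 s \<Longrightarrow> s i = 0"
    and step: "\<And>k s. I (Suc k) s \<Longrightarrow> s i > 0 \<and> runs x c C s T (I k)"
    and "I k s"
  shows "runs x c (While i C) s (k * Suc T + 1) (I 0)"
  using \<open>I k s\<close>
proof (induction k arbitrary: s)
  case 0
  then have "exec x c (While i C) s 1 s"
    by (intro exec.WhileFalse exit)
  then show ?case
    unfolding runs_def using 0 by auto
next
  case (Suc k)
  then obtain t s1 where s1: "s i > 0" "exec x c C s t s1" "t \<le> T" "I k s1"
    using step unfolding runs_def by blast
  obtain u s2 where s2: "exec x c (While i C) s1 u s2" "u \<le> k * Suc T + 1" "I 0 s2"
    using Suc.IH[OF s1(4)] unfolding runs_def by blast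
  have "exec x c (While i C) s (Suc (t + u)) s2"
    using s1 s2 by (intro exec.WhileTrue)
  moreover have "Suc (t + u) \<le> Suc k * Suc T + 1"
    using s1(3) s2(2) by simp
  ultimately show ?case
    unfolding runs_def using s2(3) by blast
qed

section \<open>Functions of an environment and their closure properties\<close>

type_synonym env_fun = "bool list \<Rightarrow> bool list \<Rightarrow> (nat \<Rightarrow> nat) \<Rightarrow> nat"

text \<open>A stack discipline: registers below \<open>r\<close> are live and survive,
  \<open>r\<close> receives the result, everything above is scratch. Nothing is assumed about the
  initial contents of the scratch registers, so the same code can be run repeatedly inside a
  loop.\<close>

definition computes :: "com \<Rightarrow> (nat \<Rightarrow> nat) \<Rightarrow> nat \<Rightarrow> env_fun \<Rightarrow> bool" where
  "computes C T r f \<longleftrightarrow> (\<forall>x c s.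
     runs x c C s (T (length x + length c)) (\<lambda>s'. s' r = f x c s \<and> (\<forall>i<r. s' i = s i)))"

text \<open>
  The last argument of \<open>f\<close> assigns values to variables; \<open>\<rho>\<close> says which register holds a variable.
  Quantifying over all \<open>\<rho>\<close> lets a loop put its bound variables into fresh registers.
\<close>

definition computable :: "env_fun \<Rightarrow> bool" where
  "computable f \<longleftrightarrow> (\<forall>\<rho> r. (\<forall>i. \<rho> i < r) \<longrightarrow>
     (\<exists>C T. poly_bounded T \<and> computes C T r (\<lambda>x c s. f x c (s \<circ> \<rho>))))"

lemma computesD:
  assumes "computes C T r f"
    and "\<And>s'. s' r = f x c s \<Longrightarrow> (\<And>i. i < r \<Longrightarrow> s' i = s i) \<Longrightarrow> Q s'"
  shows "runs x c C s (T (length x + length c)) Q"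
  by (rule runs_mono[OF assms(1)[unfolded computes_def, rule_format]]) (auto intro: assms(2))

lemma computesI:
  assumes "\<And>x c s. runs x c C s (T (length x + length c)) (\<lambda>s'. s' r = f x c s \<and> (\<forall>i<r. s' i = s i))"
  shows "computes C T r f"
  using assms by (simp add: computes_def)

lemma computableE:
  assumes "computable f" "\<And>i. \<rho> i < r"
  obtains C T where "poly_bounded T" "computes C T r (\<lambda>x c s. f x c (s \<circ> \<rho>))"
  using assms unfolding computable_def by blast

lemma comp_eq_if_agree:
  "(\<And>i. i < r \<Longrightarrow> s' i = s i) \<Longrightarrow> (\<And>i. \<rho> i < r) \<Longrightarrow> s' \<circ> \<rho> = s \<circ> \<rho>"
  by auto

lemma computableI:
  assumes "\<And>\<rho> r. (\<And>i. \<rho> i < r) \<Longrightarrow>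
    \<exists>C T. poly_bounded T \<and> computes C T r (\<lambda>x c s. f x c (s \<circ> \<rho>))"
  shows "computable f"
  using assms by (simp add: computable_def)

lemma computable_const: "computable (\<lambda>x c e. k)"
proof (rule computableI)
  fix \<rho> :: "nat \<Rightarrow> nat" and r
  have "computes (Const r k) (\<lambda>_. 1) r (\<lambda>x c s. k)"
    by (intro computesI runs_basic) simp
  then show "\<exists>C T. poly_bounded T \<and> computes C T r (\<lambda>x c s. k)"
    using poly_bounded_const by blast
qed

lemma computable_var: "computable (\<lambda>x c e. e v)"
proof (rule computableI)
  fix \<rho> :: "nat \<Rightarrow> nat" and r
  assume \<rho>: "\<And>i. \<rho> i < r"
  \<comment> \<open>The machine has no copy instruction, so the value is added to a cleared
    register.\<close>
  have "computes (Seq (Const r 0) (Add r (\<rho> v) r)) (\<lambda>_. 1 + 1) r (\<lambda>x c s. (s \<circ> \<rho>) v)"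
    by (intro computesI runs_Seq runs_basic) (use \<rho>[of v] in auto)
  then show "\<exists>C T. poly_bounded T \<and> computes C T r (\<lambda>x c s. (s \<circ> \<rho>) v)"
    using poly_bounded_const by blast
qed

lemma computable_unary:
  assumes f: "computable f"
    and op: "\<And>x c s r Q. Q (s(r := h x c (s r))) \<Longrightarrow> runs x c (op r) s 1 Q"
  shows "computable (\<lambda>x c e. h x c (f x c e))"
proof (rule computableI)
  fix \<rho> :: "nat \<Rightarrow> nat" and r
  assume \<rho>: "\<And>i. \<rho> i < r"
  obtain C T where T: "poly_bounded T" and C: "computes C T r (\<lambda>x c s. f x c (s \<circ> \<rho>))"
    using f \<rho> by (rule computableE)
  have "computes (Seq C (op r)) (\<lambda>N. T N + 1) r (\<lambda>x c s. h x c (f x c (s \<circ> \<rho>)))"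
    by (intro computesI runs_Seq computesD[OF C] op) auto
  moreover have "poly_bounded (\<lambda>N. T N + 1)"
    using T by (intro poly_bounded_intros)
  ultimately show "\<exists>C T. poly_bounded T \<and> computes C T r (\<lambda>x c s. h x c (f x c (s \<circ> \<rho>)))"
    by blast
qed

text \<open>The first operand waits in \<open>r\<close> while the second is computed into
  \<open>Suc r\<close>; the code for the second keeps all registers below \<open>Suc r\<close>,
  hence the operand as well as the variables.\<close>

lemma computable_binary:
  assumes f: "computable f" and g: "computable g"
    and op: "\<And>x c s r q Q. Q (s(r := h (s r) (s q))) \<Longrightarrow> runs x c (op r q) s 1 Q"
  shows "computable (\<lambda>x c e. h (f x c e) (g x c e))"
proof (rule computableI)
  fix \<rho> :: "nat \<Rightarrow> nat" and r
  assume \<rho>: "\<And>i. \<rho> i < r"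
  then have \<rho>': "\<And>i. \<rho> i < Suc r"
    by (simp add: less_SucI)
  obtain C S where S: "poly_bounded S" and C: "computes C S r (\<lambda>x c s. f x c (s \<circ> \<rho>))"
    using f \<rho> by (rule computableE)
  obtain D T where T: "poly_bounded T" and D: "computes D T (Suc r) (\<lambda>x c s. g x c (s \<circ> \<rho>))"
    using g \<rho>' by (rule computableE)
  have "computes (Seq C (Seq D (op r (Suc r)))) (\<lambda>N. S N + (T N + 1)) r
      (\<lambda>x c s. h (f x c (s \<circ> \<rho>)) (g x c (s \<circ> \<rho>)))"
  proof (intro computesI runs_Seq computesD[OF C] computesD[OF D] op)
    fix x c s s1 s2
    assume 1: "s1 r = f x c (s \<circ> \<rho>)" "\<And>i. i < r \<Longrightarrow> s1 i = s i"
      and 2: "s2 (Suc r) = g x c (s1 \<circ> \<rho>)" "\<And>i. i < Suc r \<Longrightarrow> s2 i = s1 i"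
    have "s1 \<circ> \<rho> = s \<circ> \<rho>"
      using 1(2) \<rho> by (rule comp_eq_if_agree)
    then show "(s2(r := h (s2 r) (s2 (Suc r)))) r = h (f x c (s \<circ> \<rho>)) (g x c (s \<circ> \<rho>)) \<and>
        (\<forall>i<r. (s2(r := h (s2 r) (s2 (Suc r)))) i = s i)"
      using 1 2 by simp
  qed
  moreover have "poly_bounded (\<lambda>N. S N + (T N + 1))"
    using S T by (intro poly_bounded_intros)
  ultimately show "\<exists>C T. poly_bounded T \<and>
      computes C T r (\<lambda>x c s. h (f x c (s \<circ> \<rho>)) (g x c (s \<circ> \<rho>)))"
    by blast
qed

lemma computable_add:
  "computable f \<Longrightarrow> computable g \<Longrightarrow> computable (\<lambda>x c e. f x c e + g x c e)"
  by (rule computable_binary[where op = "\<lambda>r q. Add r r q"]) (assumption, assumption, erule runs_basic)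

lemma computable_diff:
  "computable f \<Longrightarrow> computable g \<Longrightarrow> computable (\<lambda>x c e. f x c e - g x c e)"
  by (rule computable_binary[where op = "\<lambda>r q. Sub r r q"]) (assumption, assumption, erule runs_basic)

lemma computable_read_instance:
  "computable f \<Longrightarrow> computable (\<lambda>x c e. read_bit x (f x c e))"
  by (rule computable_unary[where op = "\<lambda>r. Read_Instance r r"]) (assumption, erule runs_basic)

lemma computable_read_cert:
  "computable f \<Longrightarrow> computable (\<lambda>x c e. read_bit c (f x c e))"
  by (rule computable_unary[where op = "\<lambda>r. Read_Cert r r"]) (assumption, erule runs_basic)

text \<open>Primitive recursion is a counted loop. \<open>B\<close> limits the number of rounds and
  not the values: the accumulator may become exponentially large, since an addition costs one step
  whatever the size of its operands. This is what allows numbers to be assembled from their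
  bits.\<close>

lemma computable_rec:
  assumes f: "computable f" and g: "computable g" and h: "computable h"
    and B: "poly_bounded B" "\<And>x c e. f x c e \<le> B (length x + length c)"
    and ab: "a \<noteq> b"
  shows "computable (\<lambda>x c e. rec_nat (g x c e) (\<lambda>k y. h x c (e(a := k, b := y))) (f x c e))"
    (is "computable (\<lambda>x c e. ?R x c e (f x c e))")
proof (rule computableI)
  fix \<rho> :: "nat \<Rightarrow> nat" and r
  assume \<rho>: "\<And>i. \<rho> i < r"
  \<comment> \<open>Frame of the loop: \<open>r\<close> holds the accumulator (variable
    \<open>b\<close>), \<open>r + 1\<close> the counter (variable \<open>a\<close>),
    \<open>r + 2\<close> the rounds left, and the code for \<open>h\<close> works from
    \<open>r + 3\<close> on.\<close>
  define \<sigma> where "\<sigma> = \<rho>(a := r + 1, b := r)"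
  have \<rho>2: "\<And>i. \<rho> i < r + 2" and \<sigma>: "\<And>i. \<sigma> i < r + 3"
    using \<rho> by (auto simp: \<sigma>_def less_SucI trans_less_add1)
  obtain Cg Tg where Tg: "poly_bounded Tg"
    and Cg: "computes Cg Tg r (\<lambda>x c s. g x c (s \<circ> \<rho>))"
    using g \<rho> by (rule computableE)
  obtain Cf Tf where Tf: "poly_bounded Tf"
    and Cf: "computes Cf Tf (r + 2) (\<lambda>x c s. f x c (s \<circ> \<rho>))"
    using f \<rho>2 by (rule computableE)
  obtain Ch Th where Th: "poly_bounded Th"
    and Ch: "computes Ch Th (r + 3) (\<lambda>x c s. h x c (s \<circ> \<sigma>))"
    using h \<sigma> by (rule computableE)
  \<comment> \<open>Once \<open>h\<close> has left its value in \<open>r + 3\<close>, register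
    \<open>r + 4\<close> is free: as 0 it turns an addition into a copy, as 1 it advances the
    counter and decreases the rounds left.\<close>
  define body where "body = Seq Ch (Seq (Const (r + 4) 0) (Seq (Add r (r + 3) (r + 4))
    (Seq (Const (r + 4) 1) (Seq (Add (r + 1) (r + 1) (r + 4)) (Sub (r + 2) (r + 2) (r + 4))))))"
  show "\<exists>C T. poly_bounded T \<and> computes C T r
      (\<lambda>x c s. ?R x c (s \<circ> \<rho>) (f x c (s \<circ> \<rho>)))"
  proof (intro exI conjI computesI)
    show "poly_bounded (\<lambda>N. Tg N + (1 + (Tf N + (B N * (1 + (Th N + 5)) + 1))))"
      using Tg Tf Th B(1) by (intro poly_bounded_intros)
    fix x c :: "bool list" and s :: "nat \<Rightarrow> nat"
    let ?N = "length x + length c" and ?e = "s \<circ> \<rho>"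
    let ?n = "f x c ?e"
    define I where "I k s' \<longleftrightarrow> s' (r + 2) = k \<and> k \<le> ?n \<and> s' (r + 1) = ?n - k \<and>
      s' r = ?R x c ?e (?n - k) \<and> (\<forall>i<r. s' i = s i)" for k s'
    have loop: "runs x c (While (r + 2) body) s0 (?n * Suc (Th ?N + 5) + 1) (I 0)"
      if "I ?n s0" for s0
    proof (rule runs_While[where I = I, OF _ _ that])
      fix k s1
      assume I: "I (Suc k) s1"
      have e: "s1 \<circ> \<sigma> = ?e(a := ?n - Suc k, b := ?R x c ?e (?n - Suc k))"
        using I \<rho> ab by (auto simp: \<sigma>_def I_def fun_eq_iff)
      have "Suc k \<le> ?n"
        using I unfolding I_def by blast
      then have "?n - k = Suc (?n - Suc k)"
        by simp
      then have hR: "h x c (s1 \<circ> \<sigma>) = ?R x c ?e (?n - k)"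
        by (simp only: e old.nat.rec(2))
      have "runs x c body s1 (Th ?N + (1 + (1 + (1 + (1 + 1)))))
        (\<lambda>s'. s' r = h x c (s1 \<circ> \<sigma>) \<and> s' (r + 1) = s1 (r + 1) + 1 \<and>
          s' (r + 2) = s1 (r + 2) - 1 \<and> (\<forall>i<r. s' i = s1 i))"
        unfolding body_def by (intro runs_Seq computesD[OF Ch] runs_basic) simp
      then have "runs x c body s1 (Th ?N + 5) (I k)"
        by (rule runs_mono) (use I in \<open>auto simp: I_def hR simp del: fun_upd_apply comp_apply\<close>)
      moreover have "s1 (r + 2) > 0"
        using I by (simp add: I_def)
      ultimately show "s1 (r + 2) > 0 \<and> runs x c body s1 (Th ?N + 5) (I k)"
        by blast
    qed (simp add: I_def)
    have final: "runs x c (While (r + 2) body) s0 (B ?N * (1 + (Th ?N + 5)) + 1)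
        (\<lambda>s'. s' r = ?R x c ?e ?n \<and> (\<forall>i<r. s' i = s i))" if "I ?n s0" for s0
    proof (rule runs_mono[OF loop[OF that]])
      show "?n * Suc (Th ?N + 5) + 1 \<le> B ?N * (1 + (Th ?N + 5)) + 1"
        using mult_right_mono[OF B(2), of "Suc (Th ?N + 5)" x c ?e] by simp
    qed (simp add: I_def)
    show "runs x c (Seq Cg (Seq (Const (r + 1) 0) (Seq Cf (While (r + 2) body)))) s
        (Tg ?N + (1 + (Tf ?N + (B ?N * (1 + (Th ?N + 5)) + 1))))
        (\<lambda>s'. s' r = ?R x c ?e ?n \<and> (\<forall>i<r. s' i = s i))"
    proof (intro runs_Seq computesD[OF Cg] computesD[OF Cf] runs_basic final)
      fix s1 s2
      assume 1: "s1 r = g x c (s \<circ> \<rho>)" "\<And>i. i < r \<Longrightarrow> s1 i = s i"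
        and 2: "s2 (r + 2) = f x c (s1(r + 1 := 0) \<circ> \<rho>)"
          "\<And>i. i < r + 2 \<Longrightarrow> s2 i = (s1(r + 1 := 0)) i"
      have "s1(r + 1 := 0) \<circ> \<rho> = s \<circ> \<rho>"
        by (rule comp_eq_if_agree[OF _ \<rho>]) (use 1(2) in auto)
      then show "I ?n s2"
        using 1 2 by (simp add: I_def comp_def)
    qed
  qed
qed

text \<open>Linear search from 0 with the candidate in \<open>r\<close> and its test value in
  \<open>r + 1\<close>. The zero promised below \<open>B\<close> makes the search end within
  polynomially many rounds in every environment.\<close>

lemma computable_Least:
  assumes g: "computable g"
    and B: "poly_bounded B" "\<And>x c e. \<exists>k \<le> B (length x + length c). g x c (e(a := k)) = 0"
  shows "computable (\<lambda>x c e. LEAST k. g x c (e(a := k)) = 0)"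
proof (rule computableI)
  fix \<rho> :: "nat \<Rightarrow> nat" and r
  assume \<rho>: "\<And>i. \<rho> i < r"
  define \<sigma> where "\<sigma> = \<rho>(a := r)"
  have \<sigma>: "\<And>i. \<sigma> i < r + 1"
    using \<rho> by (auto simp: \<sigma>_def less_SucI)
  obtain Cg Tg where Tg: "poly_bounded Tg"
    and Cg: "computes Cg Tg (r + 1) (\<lambda>x c s. g x c (s \<circ> \<sigma>))"
    using g \<sigma> by (rule computableE)
  define body where "body = Seq (Const (r + 1) 1) (Seq (Add r r (r + 1)) Cg)"
  show "\<exists>C T. poly_bounded T \<and> computes C T r
      (\<lambda>x c s. (LEAST k. g x c ((s \<circ> \<rho>)(a := k)) = 0))"
  proof (intro exI conjI computesI)
    show "poly_bounded (\<lambda>N. 1 + (Tg N + (B N * (1 + (1 + (1 + Tg N))) + 1)))"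
      using Tg B(1) by (intro poly_bounded_intros)
    fix x c :: "bool list" and s :: "nat \<Rightarrow> nat"
    let ?N = "length x + length c" and ?e = "s \<circ> \<rho>"
    define m where "m = (LEAST k. g x c (?e(a := k)) = 0)"
    obtain k0 where k0: "k0 \<le> B ?N" "g x c (?e(a := k0)) = 0"
      using B(2) by blast
    have m: "g x c (?e(a := m)) = 0" and mB: "m \<le> B ?N"
      using k0 LeastI[of "\<lambda>k. g x c (?e(a := k)) = 0" k0]
        Least_le[of "\<lambda>k. g x c (?e(a := k)) = 0" k0] by (auto simp: m_def)
    have less_m: "g x c (?e(a := k)) > 0" if "k < m" for k
      using that not_less_Least[of k "\<lambda>k. g x c (?e(a := k)) = 0"] by (simp add: m_def)
    \<comment> \<open>Here \<open>k\<close> counts the candidates still to be passed over, so the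
      current one is \<open>m - k\<close>.\<close>
    define I where "I k s' \<longleftrightarrow> k \<le> m \<and> s' r = m - k \<and>
      s' (r + 1) = g x c (?e(a := m - k)) \<and> (\<forall>i<r. s' i = s i)" for k s'
    have upd: "s1 \<circ> \<sigma> = ?e(a := s1 r)" if "\<And>i. i < r \<Longrightarrow> s1 i = s i" for s1
      using that \<rho> by (auto simp: \<sigma>_def fun_eq_iff)
    have loop: "runs x c (While (r + 1) body) s0 (m * Suc (1 + (1 + Tg ?N)) + 1) (I 0)"
      if "I m s0" for s0
    proof (rule runs_While[where I = I, OF _ _ that])
      fix k s1
      assume I: "I (Suc k) s1"
      show "s1 (r + 1) > 0 \<and> runs x c body s1 (1 + (1 + Tg ?N)) (I k)"
      proof
        show "s1 (r + 1) > 0"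
          using I less_m[of "m - Suc k"] by (simp add: I_def)
        show "runs x c body s1 (1 + (1 + Tg ?N)) (I k)"
          unfolding body_def
        proof (intro runs_Seq runs_basic computesD[OF Cg])
          fix s2
          let ?s = "s1(r + 1 := 1, r := (s1(r + 1 := 1)) r + (s1(r + 1 := 1)) (r + 1))"
          assume s2: "s2 (r + 1) = g x c (?s \<circ> \<sigma>)" "\<And>i. i < r + 1 \<Longrightarrow> s2 i = ?s i"
          have "?s \<circ> \<sigma> = ?e(a := ?s r)"
            by (rule upd) (use I in \<open>auto simp: I_def\<close>)
          moreover have "?s r = m - k"
            using I by (auto simp: I_def)
          ultimately show "I k s2"
            using s2 I by (auto simp: I_def)
        qed
      qed
    qed (simp add: I_def m)
    have final: "runs x c (While (r + 1) body) s0 (B ?N * (1 + (1 + (1 + Tg ?N))) + 1)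
        (\<lambda>s'. s' r = m \<and> (\<forall>i<r. s' i = s i))" if "I m s0" for s0
    proof (rule runs_mono[OF loop[OF that]])
      show "m * Suc (1 + (1 + Tg ?N)) + 1 \<le> B ?N * (1 + (1 + (1 + Tg ?N))) + 1"
        using mult_right_mono[OF mB, of "Suc (1 + (1 + Tg ?N))"] by simp
    qed (simp add: I_def)
    show "runs x c (Seq (Const r 0) (Seq Cg (While (r + 1) body))) s
        (1 + (Tg ?N + (B ?N * (1 + (1 + (1 + Tg ?N))) + 1)))
        (\<lambda>s'. s' r = (LEAST k. g x c (?e(a := k)) = 0) \<and> (\<forall>i<r. s' i = s i))"
      unfolding m_def[symmetric]
    proof (intro runs_Seq runs_basic computesD[OF Cg] final)
      fix s2
      assume s2: "s2 (r + 1) = g x c (s(r := 0) \<circ> \<sigma>)" "\<And>i. i < r + 1 \<Longrightarrow> s2 i = (s(r := 0)) i"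
      have "s(r := 0) \<circ> \<sigma> = ?e(a := 0)"
        using upd[of "s(r := 0)"] by simp
      then show "I m s2"
        using s2 by (simp add: I_def)
    qed
  qed
qed

text \<open>The value of \<open>g\<close> is left in \<open>r\<close>, and \<open>r\<close> then
  acts as variable \<open>a\<close> for the code of \<open>f\<close>. This relies on
  \<open>computable\<close> providing code for every assignment of variables to registers.\<close>

lemma computable_subst:
  assumes f: "computable f" and g: "computable g"
  shows "computable (\<lambda>x c e. f x c (e(a := g x c e)))"
proof (rule computableI)
  fix \<rho> :: "nat \<Rightarrow> nat" and r
  assume \<rho>: "\<And>i. \<rho> i < r"
  define \<sigma> where "\<sigma> = \<rho>(a := r)"
  have \<sigma>: "\<And>i. \<sigma> i < r + 1"
    using \<rho> by (auto simp: \<sigma>_def less_SucI)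
  obtain Cf Tf where Tf: "poly_bounded Tf"
    and Cf: "computes Cf Tf (r + 1) (\<lambda>x c s. f x c (s \<circ> \<sigma>))"
    using f \<sigma> by (rule computableE)
  obtain Cg Tg where Tg: "poly_bounded Tg"
    and Cg: "computes Cg Tg r (\<lambda>x c s. g x c (s \<circ> \<rho>))"
    using g \<rho> by (rule computableE)
  have "computes (Seq Cg (Seq Cf (Seq (Const r 0) (Add r r (r + 1)))))
      (\<lambda>N. Tg N + (Tf N + (1 + 1))) r (\<lambda>x c s. f x c ((s \<circ> \<rho>)(a := g x c (s \<circ> \<rho>))))"
  proof (intro computesI runs_Seq computesD[OF Cf] computesD[OF Cg] runs_basic)
    fix x c and s s1 s2 :: "nat \<Rightarrow> nat"
    assume 1: "s1 r = g x c (s \<circ> \<rho>)" "\<And>i. i < r \<Longrightarrow> s1 i = s i"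
      and 2: "s2 (r + 1) = f x c (s1 \<circ> \<sigma>)" "\<And>i. i < r + 1 \<Longrightarrow> s2 i = s1 i"
    have "s1 \<circ> \<sigma> = (s \<circ> \<rho>)(a := g x c (s \<circ> \<rho>))"
      using 1 \<rho> by (auto simp: \<sigma>_def fun_eq_iff)
    then show "(s2(r := 0, r := (s2(r := 0)) r + (s2(r := 0)) (r + 1))) r =
          f x c ((s \<circ> \<rho>)(a := g x c (s \<circ> \<rho>))) \<and>
        (\<forall>i<r. (s2(r := 0, r := (s2(r := 0)) r + (s2(r := 0)) (r + 1))) i = s i)"
      using 1 2 by simp
  qed
  moreover have "poly_bounded (\<lambda>N. Tg N + (Tf N + (1 + 1)))"
    using Tf Tg by (intro poly_bounded_intros)
  ultimately show "\<exists>C T. poly_bounded T \<and>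
      computes C T r (\<lambda>x c s. f x c ((s \<circ> \<rho>)(a := g x c (s \<circ> \<rho>))))"
    by blast
qed

text \<open>Repeated addition with \<open>f\<close> as the number of rounds, hence the bound on
  \<open>f\<close> alone. The multiplicand is a variable because it is evaluated anew in each round,
  after \<open>v + 1\<close> and \<open>v + 2\<close> have been overwritten by counter and
  accumulator.\<close>

lemma computable_mult_var:
  assumes f: "computable f"
    and B: "poly_bounded B" "\<And>x c e. f x c e \<le> B (length x + length c)"
  shows "computable (\<lambda>x c e. f x c e * e v)"
proof -
  have "computable (\<lambda>x c e. rec_nat 0 (\<lambda>k y. (\<lambda>x c e. e (v + 2) + e v) x c
      (e(v + 1 := k, v + 2 := y))) (f x c e))"
    by (intro computable_rec[OF f _ _ B] computable_add computable_const computable_var) simp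
  moreover have "rec_nat 0 (\<lambda>k y. y + m) n = n * m" for m n :: nat
    by (induction n) auto
  ultimately show ?thesis
    by simp
qed

text \<open>The second factor is substituted for variable 0. The substitution also reaches the first
  factor, which is therefore taken to be independent of the environment.\<close>

lemma computable_mult:
  assumes f: "computable (\<lambda>x c e. f x c)" and g: "computable g"
    and B: "poly_bounded B" "\<And>x c. f x c \<le> B (length x + length c)"
  shows "computable (\<lambda>x c e. f x c * g x c e)"
  using computable_subst[OF computable_mult_var[OF f B, where v = 0] g, of 0] by simp

section \<open>Decidable predicates and bounded quantifiers\<close>

abbreviation decidable :: "(bool list \<Rightarrow> bool list \<Rightarrow> (nat \<Rightarrow> nat) \<Rightarrow> bool) \<Rightarrow> bool" where
  "decidable P \<equiv> computable (\<lambda>x c e. of_bool (P x c e))"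

lemma decidable_not:
  assumes "decidable P"
  shows "decidable (\<lambda>x c e. \<not> P x c e)"
proof -
  have "computable (\<lambda>x c e. 1 - of_bool (P x c e))"
    by (intro computable_diff computable_const assms)
  moreover have "1 - of_bool p = (of_bool (\<not> p) :: nat)" for p
    by auto
  ultimately show ?thesis
    by simp
qed

lemma decidable_conj:
  assumes "decidable P" "decidable Q"
  shows "decidable (\<lambda>x c e. P x c e \<and> Q x c e)"
proof -
  have "computable (\<lambda>x c e. of_bool (P x c e) - (1 - of_bool (Q x c e)))"
    by (intro computable_diff computable_const assms)
  moreover have "of_bool p - (1 - of_bool q) = (of_bool (p \<and> q) :: nat)" for p q
    by auto
  ultimately show ?thesis
    by simp
qed

lemma decidable_imp:
  assumes "decidable P" "decidable Q"
  shows "decidable (\<lambda>x c e. P x c e \<longrightarrow> Q x c e)"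
  using decidable_not[OF decidable_conj[OF assms(1) decidable_not[OF assms(2)]]] by simp

lemma decidable_iff:
  assumes "decidable P" "decidable Q"
  shows "decidable (\<lambda>x c e. P x c e \<longleftrightarrow> Q x c e)"
  using decidable_conj[OF decidable_imp[OF assms] decidable_imp[OF assms(2,1)]]
  by (simp add: iff_conv_conj_imp)

lemma decidable_le:
  assumes "computable f" "computable g"
  shows "decidable (\<lambda>x c e. f x c e \<le> g x c e)"
proof -
  have "computable (\<lambda>x c e. 1 - (f x c e - g x c e))"
    by (intro computable_diff computable_const assms)
  moreover have "1 - (m - n) = (of_bool (m \<le> n) :: nat)" for m n :: nat
    by auto
  ultimately show ?thesis
    by simp
qed

lemma decidable_less:
  assumes "computable f" "computable g"
  shows "decidable (\<lambda>x c e. f x c e < g x c e)"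
  using decidable_not[OF decidable_le[OF assms(2,1)]] by (simp add: not_le)

lemma decidable_eq:
  assumes "computable f" "computable g"
  shows "decidable (\<lambda>x c e. f x c e = g x c e)"
  using decidable_conj[OF decidable_le[OF assms] decidable_le[OF assms(2,1)]]
  by (simp add: eq_iff)

lemma computable_Least_decidable:
  assumes P: "decidable P"
    and B: "poly_bounded B" "\<And>x c e. \<exists>k \<le> B (length x + length c). P x c (e(a := k))"
  shows "computable (\<lambda>x c e. LEAST k. P x c (e(a := k)))"
  using computable_Least[OF decidable_not[OF P] B(1), of a] B(2) by simp

text \<open>A bounded quantifier is a search for a counterexample: the condition holds vacuously at
  \<open>m\<close>, so the search stops there at the latest, and it gets as far as \<open>m\<close>
  exactly if it meets no counterexample.\<close>

lemma less_Least_iff_all_less: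
  fixes m :: nat
  shows "m \<le> (LEAST k. k < m \<longrightarrow> \<not> P k) \<longleftrightarrow> (\<forall>k<m. P k)"
proof
  assume "m \<le> (LEAST k. k < m \<longrightarrow> \<not> P k)"
  then have "\<not> (k < m \<longrightarrow> \<not> P k)" if "k < m" for k
    using that by (intro not_less_Least) simp
  then show "\<forall>k<m. P k"
    by blast
next
  assume "\<forall>k<m. P k"
  moreover have "(LEAST k. k < m \<longrightarrow> \<not> P k) < m \<longrightarrow> \<not> P (LEAST k. k < m \<longrightarrow> \<not> P k)"
    by (rule LeastI[of _ m]) simp
  ultimately show "m \<le> (LEAST k. k < m \<longrightarrow> \<not> P k)"
    by (meson not_le)
qed

lemma decidable_all_less:
  assumes f: "computable (\<lambda>x c e. f x c)" and P: "decidable P"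
    and B: "poly_bounded B" "\<And>x c. f x c \<le> B (length x + length c)"
  shows "decidable (\<lambda>x c e. \<forall>k<f x c. P x c (e(a := k)))"
proof -
  have "decidable (\<lambda>x c e. e a < f x c \<longrightarrow> \<not> P x c e)"
    by (intro decidable_imp decidable_less decidable_not computable_var f P)
  moreover have "\<exists>k\<le>B (length x + length c). (e(a := k)) a < f x c \<longrightarrow> \<not> P x c (e(a := k))" for x c e
    using B(2)[of x c] by (intro exI[of _ "f x c"]) simp
  ultimately have "computable (\<lambda>x c e. LEAST k. (e(a := k)) a < f x c \<longrightarrow> \<not> P x c (e(a := k)))"
    using B(1) by (intro computable_Least_decidable)
  then have "decidable (\<lambda>x c e. f x c \<le> (LEAST k. k < f x c \<longrightarrow> \<not> P x c (e(a := k))))"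
    using f by (intro decidable_le) simp_all
  then show ?thesis
    by (simp only: less_Least_iff_all_less)
qed

text \<open>Reading past the end yields 2, which differs from both bit values, so the length is the
  first position where 2 is read.\<close>

lemma computable_length_instance: "computable (\<lambda>x c e. length x)"
proof -
  have "computable (\<lambda>x c e. LEAST k. (\<lambda>x c e. read_bit x (e 0) = 2) x c (e(0 := k)))"
    by (intro computable_Least_decidable[OF _ poly_bounded_id] decidable_eq
        computable_read_instance computable_var computable_const)
      (auto simp: read_bit_def)
  moreover have "(LEAST k. read_bit x k = 2) = length x" for x
    by (rule Least_equality) (auto simp: read_bit_def of_bool_def split: if_splits)
  ultimately show ?thesis
    by simp
qed

theorem decidable_verifier:
  assumes "decidable (\<lambda>x c e. P x c)"
  obtains C where "polynomial_time C" "\<And>x c. accepts C x c \<longleftrightarrow> P x c"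
proof -
  \<comment> \<open>The predicate ignores the environment, so all variables may share register 0.
    The result arrives in register 1 and is then copied to register 0, where acceptance looks for
    it.\<close>
  obtain D T where T: "poly_bounded T"
    and D: "computes D T 1 (\<lambda>x c s. of_bool (P x c))"
    using assms[unfolded computable_def, rule_format, of "\<lambda>_. 0" 1] by blast
  define C where "C = Seq D (Seq (Const 0 0) (Add 0 0 1))"
  have C: "runs x c C s (T (length x + length c) + (1 + 1)) (\<lambda>s'. s' 0 = of_bool (P x c))" for x c s
    unfolding C_def by (intro runs_Seq computesD[OF D] runs_basic) simp
  have "poly_bounded (\<lambda>N. T N + (1 + 1))"
    using T by (intro poly_bounded_intros)
  then obtain p :: "nat poly" where p: "\<And>N. T N + (1 + 1) \<le> poly p N"
    unfolding poly_bounded_def by blast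
  show thesis
  proof
    have "\<exists>t s. exec x c C (\<lambda>_. 0) t s \<and> t \<le> poly p (length x + length c)" for x c
      using C[of x c "\<lambda>_. 0"] p[of "length x + length c"] unfolding runs_def
      by (meson le_trans)
    then show "polynomial_time C"
      unfolding polynomial_time_def by blast
    show "accepts C x c \<longleftrightarrow> P x c" for x c
    proof -
      obtain t s where s: "exec x c C (\<lambda>_. 0) t s" "s 0 = of_bool (P x c)"
        using C[of x c "\<lambda>_. 0"] unfolding runs_def by blast
      \<comment> \<open>Acceptance asks for some run; determinism identifies that run with the one
        just obtained.\<close>
      have "accepts C x c \<longleftrightarrow> s 0 = 1"
        unfolding accepts_def using s(1) exec_deterministic[OF s(1)] by blast
      then show ?thesis
        using s(2) by simp
    qed
  qed
qed

section \<open>The verifier\<close>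

text \<open>Recovers the number of vertices from the length of an adjacency matrix. Rounding up
  makes it total; lengths that are not squares are caught by a separate test.\<close>

definition ceil_sqrt :: "nat \<Rightarrow> nat" where
  "ceil_sqrt L = (LEAST m. L \<le> m * m)"

definition field_width :: "bool list \<Rightarrow> nat" where
  "field_width c = (LEAST k. read_bit c k \<noteq> 1)"

text \<open>Horner's scheme. Behind the end of the string the value 2 enters as a digit, which does
  no harm because any numbers that pass the tests are acceptable.\<close>

definition read_number :: "bool list \<Rightarrow> nat \<Rightarrow> nat \<Rightarrow> nat" where
  "read_number c p w = rec_nat 0 (\<lambda>k y. y + y + read_bit c (p + k)) w"

text \<open>
  A certificate is \<open>1\<^sup>w0\<close> followed by numbers of \<open>w\<close> bits each, most significant bit first; they
  are counted from 1, and vertex \<open>i\<close> owns the numbers \<open>4i + 1, \<dots>, 4i + 4\<close>.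
\<close>

definition field :: "bool list \<Rightarrow> nat \<Rightarrow> nat" where
  "field c q = read_number c (field_width c * q + 1) (field_width c)"

text \<open>
  Vertex \<open>i\<close> is horizontal if \<open>s i = 0\<close> and vertical otherwise; its lower left end is \<open>(X i, Y i)\<close>,
  and \<open>Z i\<close> is the upper end of a vertical segment. The unit of length is \<open>n\<close>.
\<close>

definition consistent ::
    "bool \<Rightarrow> nat \<Rightarrow> (nat \<Rightarrow> nat \<Rightarrow> bool) \<Rightarrow> (nat \<Rightarrow> nat) \<Rightarrow> (nat \<Rightarrow> nat) \<Rightarrow> (nat \<Rightarrow> nat) \<Rightarrow> (nat \<Rightarrow> nat) \<Rightarrow>
     nat \<Rightarrow> nat \<Rightarrow> bool" where
  "consistent unit n A s X Y Z i j \<longleftrightarrow>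
     (A i j \<longleftrightarrow> A j i) \<and> (A i j \<longrightarrow> (s i = 0 \<longleftrightarrow> \<not> s j = 0)) \<and>
     (s i = 0 \<and> \<not> s j = 0 \<longrightarrow>
       (A i j \<longleftrightarrow> X i \<le> X j \<and> X j \<le> X i + n \<and> Y j \<le> Y i \<and> Y i \<le> Z j)) \<and>
     (s i = 0 \<and> s j = 0 \<and> \<not> i = j \<longrightarrow>
       \<not> (Y i = Y j \<and> X i \<le> X j + n \<and> X j \<le> X i + n)) \<and>
     (\<not> s i = 0 \<and> \<not> s j = 0 \<and> \<not> i = j \<longrightarrow> \<not> (X i = X j \<and> Y i \<le> Z j \<and> Y j \<le> Z i)) \<and>
     (\<not> s i = 0 \<longrightarrow> Y i < Z i \<and> (unit \<longrightarrow> Z i = Y i + n))"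

definition verifies :: "bool \<Rightarrow> bool list \<Rightarrow> bool list \<Rightarrow> bool" where
  "verifies unit x c \<longleftrightarrow>
     (let n = ceil_sqrt (length x) in n * n = length x \<and>
        (\<forall>i<n. \<forall>j<n. consistent unit n (\<lambda>i j. read_bit x (n * i + j) = 1)
           (\<lambda>i. field c (4 * i + 1)) (\<lambda>i. field c (4 * i + 2)) (\<lambda>i. field c (4 * i + 3))
           (\<lambda>i. field c (4 * i + 4)) i j))"

lemma ceil_sqrt_le: "ceil_sqrt L \<le> L"
  unfolding ceil_sqrt_def by (rule Least_le) simp

lemma ceil_sqrt_square: "ceil_sqrt (n * n) = n"
  unfolding ceil_sqrt_def
proof (rule Least_equality)
  fix m
  assume "n * n \<le> m * m"
  then show "n \<le> m"
    by (meson linorder_not_less mult_strict_mono' zero_le)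
qed simp

lemma computable_ceil_sqrt: "computable (\<lambda>x c e. ceil_sqrt (length x))"
proof -
  \<comment> \<open>\<open>?f\<close> is the minimum of \<open>e 0\<close> and
    \<open>length x\<close>. A product needs a factor that is bounded in every environment, and
    capping one factor \<open>k\<close> at \<open>length x\<close> does not affect whether
    \<open>k * k\<close> reaches \<open>length x\<close>.\<close>
  let ?f = "\<lambda>(x :: bool list) (c :: bool list) e. e 0 - (e 0 - length x)"
  have "computable (\<lambda>x c e. ?f x c e * e 0)"
    by (intro computable_mult_var[OF _ poly_bounded_id] computable_diff computable_var
        computable_length_instance) auto
  then have "decidable (\<lambda>x c e. length x \<le> ?f x c e * e 0)"
    by (intro decidable_le computable_length_instance)
  moreover have "\<exists>k\<le>length x + length c. length x \<le> ?f x c (e(0 := k)) * (e(0 := k)) 0" for x c e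
    by (intro exI[of _ "length x"]) (simp add: Suc_le_eq)
  ultimately have "computable (\<lambda>x c e. LEAST k. length x \<le> ?f x c (e(0 := k)) * (e(0 := k)) 0)"
    by (rule computable_Least_decidable[OF _ poly_bounded_id])
  moreover have "L \<le> (k - (k - L)) * k \<longleftrightarrow> L \<le> k * k" for k L :: nat
  proof (cases "k \<le> L")
    case False
    then have "L \<le> L * k" "L \<le> k * k"
      by (simp_all add: trans_le_add1 le_trans[of L k "k * k"])
    with False show ?thesis
      by simp
  qed simp
  ultimately show ?thesis
    by (simp add: ceil_sqrt_def)
qed

lemma field_width_le: "field_width c \<le> length c"
  unfolding field_width_def by (rule Least_le) (simp add: read_bit_def)

lemma computable_field_width: "computable (\<lambda>x c e. field_width c)"
proof -
  have "decidable (\<lambda>x c e. \<not> read_bit c (e 0) = 1)"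
    by (intro decidable_not decidable_eq computable_read_cert computable_var computable_const)
  moreover have "\<exists>k\<le>length x + length c. \<not> read_bit c ((e(0 := k)) 0) = 1"
    for x c :: "bool list" and e
    by (intro exI[of _ "length c"]) (simp add: read_bit_def)
  ultimately have "computable (\<lambda>x c e. LEAST k. \<not> read_bit c ((e(0 := k)) 0) = 1)"
    by (rule computable_Least_decidable[OF _ poly_bounded_id])
  then show ?thesis
    by (simp add: field_width_def)
qed

lemma computable_field:
  assumes "computable q"
  shows "computable (\<lambda>x c e. field c (q x c e))"
proof -
  let ?h = "\<lambda>x c e. e 2 + e 2 + read_bit c (e 0 + e 1)"
  have "computable ?h"
    by (intro computable_add computable_read_cert computable_var)
  then have "computable (\<lambda>x c e. rec_nat 0 (\<lambda>k y. ?h x c (e(1 := k, 2 := y))) (field_width c))"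
    using field_width_le by (intro computable_rec[OF _ _ _ poly_bounded_id] computable_field_width
        computable_const) (auto intro: trans_le_add2)
  moreover have "computable (\<lambda>x c e. field_width c * q x c e + 1)"
    using field_width_le by (intro computable_add computable_mult[OF _ _ poly_bounded_id]
        computable_field_width computable_const assms) (auto intro: trans_le_add2)
  ultimately have "computable (\<lambda>x c e. rec_nat 0 (\<lambda>k y. ?h x c (e(0 := field_width c * q x c e + 1,
      1 := k, 2 := y))) (field_width c))"
    by (rule computable_subst)
  then show ?thesis
    by (simp add: field_def read_number_def)
qed

lemma decidable_verifies: "decidable (\<lambda>x c e. verifies unit x c)"
proof -
  let ?n = "\<lambda>x. ceil_sqrt (length x)"
  have n: "ceil_sqrt (length x) \<le> length x + length c" for x c :: "bool list"
    using ceil_sqrt_le by (rule trans_le_add1)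
  have 4: "computable (\<lambda>x c e. field c (4 * e v + k))" for v k
    by (intro computable_field computable_add computable_mult[OF _ _ poly_bounded_const[of 4]]
        computable_const computable_var order_refl)
  have A: "decidable (\<lambda>x c e. read_bit x (?n x * e v + e w) = 1)" for v w
    by (intro decidable_eq computable_read_instance computable_add
        computable_mult[OF _ _ poly_bounded_id n] computable_ceil_sqrt computable_const computable_var)
  have "decidable (\<lambda>x c e. consistent unit (?n x) (\<lambda>i j. read_bit x (?n x * i + j) = 1)
           (\<lambda>i. field c (4 * i + 1)) (\<lambda>i. field c (4 * i + 2)) (\<lambda>i. field c (4 * i + 3))
           (\<lambda>i. field c (4 * i + 4)) (e 0) (e 1))"
    unfolding consistent_def
    by (intro decidable_conj decidable_imp decidable_not decidable_iff decidable_less decidable_eq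
        decidable_le A 4 computable_add computable_ceil_sqrt computable_const computable_var)
  \<comment> \<open>Reading the indices back from an updated environment gives both quantifiers the
    form treated by \<open>decidable_all_less\<close>: variable 0 is bound outside, variable 1
    inside.\<close>
  then have "decidable (\<lambda>x c e. ?n x * ?n x = length x \<and> (\<forall>i<?n x. \<forall>j<?n x.
      consistent unit (?n x) (\<lambda>i j. read_bit x (?n x * i + j) = 1)
           (\<lambda>i. field c (4 * i + 1)) (\<lambda>i. field c (4 * i + 2)) (\<lambda>i. field c (4 * i + 3))
           (\<lambda>i. field c (4 * i + 4)) ((e(0 := i, 1 := j)) 0) ((e(0 := i, 1 := j)) 1)))"
    by (intro decidable_conj decidable_eq computable_mult[OF _ _ poly_bounded_id n]
        computable_ceil_sqrt computable_length_instance
        decidable_all_less[OF _ _ poly_bounded_id n,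
          of "\<lambda>x c e. \<forall>j<?n x. consistent unit (?n x) (\<lambda>i j. read_bit x (?n x * i + j) = 1)
           (\<lambda>i. field c (4 * i + 1)) (\<lambda>i. field c (4 * i + 2)) (\<lambda>i. field c (4 * i + 3))
           (\<lambda>i. field c (4 * i + 4)) ((e(1 := j)) 0) ((e(1 := j)) 1)" 0]
        decidable_all_less[OF _ _ poly_bounded_id n])
  then show ?thesis
    by (simp add: verifies_def Let_def)
qed

section \<open>Representations by real coordinates\<close>

text \<open>\<open>(a w, b w)\<close> is the left or lower end of the segment of \<open>w\<close>,
  and \<open>l w\<close> is its length. All geometric conditions thereby become equations and
  inequalities between coordinates, which is all that rounding has to preserve.\<close>

definition grid_coordinates ::
    "'a pair_pre_digraph \<Rightarrow> 'a set \<Rightarrow> 'a set \<Rightarrow> ('a \<Rightarrow> real) \<Rightarrow> ('a \<Rightarrow> real) \<Rightarrow> ('a \<Rightarrow> real) \<Rightarrow> bool"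
  where
  "grid_coordinates G H V a b l \<longleftrightarrow>
     (\<forall>w\<in>H \<union> V. l w > 0) \<and>
     (\<forall>u\<in>H. \<forall>u'\<in>H. u \<noteq> u' \<longrightarrow> \<not> (b u = b u' \<and> a u \<le> a u' + l u' \<and> a u' \<le> a u + l u)) \<and>
     (\<forall>v\<in>V. \<forall>v'\<in>V. v \<noteq> v' \<longrightarrow> \<not> (a v = a v' \<and> b v \<le> b v' + l v' \<and> b v' \<le> b v + l v)) \<and>
     (\<forall>u\<in>H. \<forall>v\<in>V. (u, v) \<in> parcs G \<longleftrightarrow>
        a u \<le> a v \<and> a v \<le> a u + l u \<and> b v \<le> b u \<and> b u \<le> b v + l v)"

lemma closed_segment_horizontal:
  fixes x y l :: real
  assumes "l > 0"
  shows "closed_segment (x, y) (x + l, y) = {x..x + l} \<times> {y}"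
proof -
  have "(p, q) \<in> closed_segment (x, y) (x + l, y) \<longleftrightarrow> p \<in> closed_segment x (x + l) \<and> q = y" for p q
    by (auto simp: closed_segment_def algebra_simps)
  then show ?thesis
    using assms by (auto simp: closed_segment_eq_real_ivl)
qed

lemma closed_segment_vertical:
  fixes x y l :: real
  assumes "l > 0"
  shows "closed_segment (x, y) (x, y + l) = {x} \<times> {y..y + l}"
proof -
  have "(p, q) \<in> closed_segment (x, y) (x, y + l) \<longleftrightarrow> q \<in> closed_segment y (y + l) \<and> p = x" for p q
    by (auto simp: closed_segment_def algebra_simps)
  then show ?thesis
    using assms by (auto simp: closed_segment_eq_real_ivl)
qed

lemma horizontal_segment_iff:
  "horizontal_segment l S \<longleftrightarrow> l > 0 \<and> (\<exists>x y. S = {x..x + l} \<times> {y})"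
  unfolding horizontal_segment_def by (simp add: closed_segment_horizontal cong: conj_cong)

lemma vertical_segment_iff:
  "vertical_segment l S \<longleftrightarrow> l > 0 \<and> (\<exists>x y. S = {x} \<times> {y..y + l})"
  unfolding vertical_segment_def by (simp add: closed_segment_vertical cong: conj_cong)

lemma Icc_Int_Icc_empty_iff:
  fixes a b k l :: real
  assumes "k > 0" "l > 0"
  shows "{a..a + k} \<inter> {b..b + l} = {} \<longleftrightarrow> \<not> (a \<le> b + l \<and> b \<le> a + k)"
  using assms by (auto simp: Int_atLeastAtMost)

lemma grid_intersection_rep_iff:
  assumes H: "\<And>u. u \<in> H \<Longrightarrow> l u > 0 \<and> S u = {a u..a u + l u} \<times> {b u}"
    and V: "\<And>v. v \<in> V \<Longrightarrow> l v > 0 \<and> S v = {a v} \<times> {b v..b v + l v}"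
  shows "grid_intersection_rep G H V S \<longleftrightarrow> grid_coordinates G H V a b l"
proof -
  have h: "\<forall>u\<in>H. \<exists>k. horizontal_segment k (S u)"
    using H unfolding horizontal_segment_iff by blast
  have v: "\<forall>v\<in>V. \<exists>k. vertical_segment k (S v)"
    using V unfolding vertical_segment_iff by blast
  have pos: "\<forall>w\<in>H \<union> V. l w > 0"
    using H V by blast
  have hh: "S u \<inter> S u' = {} \<longleftrightarrow> \<not> (b u = b u' \<and> a u \<le> a u' + l u' \<and> a u' \<le> a u + l u)"
    if "u \<in> H" "u' \<in> H" for u u'
  proof -
    have "S u \<inter> S u' = ({a u..a u + l u} \<inter> {a u'..a u' + l u'}) \<times> ({b u} \<inter> {b u'})"
      using H[OF that(1)] H[OF that(2)] by (simp add: Times_Int_Times)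
    moreover have "{a u..a u + l u} \<inter> {a u'..a u' + l u'} = {} \<longleftrightarrow>
        \<not> (a u \<le> a u' + l u' \<and> a u' \<le> a u + l u)"
      using H[OF that(1)] H[OF that(2)] by (intro Icc_Int_Icc_empty_iff) auto
    moreover have "{b u} \<inter> {b u'} = {} \<longleftrightarrow> b u \<noteq> b u'"
      by auto
    ultimately show ?thesis
      by (metis Times_empty)
  qed
  have vv: "S v \<inter> S v' = {} \<longleftrightarrow> \<not> (a v = a v' \<and> b v \<le> b v' + l v' \<and> b v' \<le> b v + l v)"
    if "v \<in> V" "v' \<in> V" for v v'
  proof -
    have "S v \<inter> S v' = ({a v} \<inter> {a v'}) \<times> ({b v..b v + l v} \<inter> {b v'..b v' + l v'})"
      using V[OF that(1)] V[OF that(2)] by (simp add: Times_Int_Times)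
    moreover have "{b v..b v + l v} \<inter> {b v'..b v' + l v'} = {} \<longleftrightarrow>
        \<not> (b v \<le> b v' + l v' \<and> b v' \<le> b v + l v)"
      using V[OF that(1)] V[OF that(2)] by (intro Icc_Int_Icc_empty_iff) auto
    moreover have "{a v} \<inter> {a v'} = {} \<longleftrightarrow> a v \<noteq> a v'"
      by auto
    ultimately show ?thesis
      by (metis Times_empty)
  qed
  have hv: "S u \<inter> S v \<noteq> {} \<longleftrightarrow> a u \<le> a v \<and> a v \<le> a u + l u \<and> b v \<le> b u \<and> b u \<le> b v + l v"
    if "u \<in> H" "v \<in> V" for u v
  proof -
    have "S u \<inter> S v = ({a u..a u + l u} \<inter> {a v}) \<times> ({b u} \<inter> {b v..b v + l v})"
      using H[OF that(1)] V[OF that(2)] by (simp add: Times_Int_Times)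
    moreover have "{a u..a u + l u} \<inter> {a v} = {} \<longleftrightarrow> \<not> (a u \<le> a v \<and> a v \<le> a u + l u)"
      by auto
    moreover have "{b u} \<inter> {b v..b v + l v} = {} \<longleftrightarrow> \<not> (b v \<le> b u \<and> b u \<le> b v + l v)"
      by auto
    ultimately show ?thesis
      by (metis Times_empty)
  qed
  have 1: "(\<forall>u\<in>H. \<forall>u'\<in>H. u \<noteq> u' \<longrightarrow> S u \<inter> S u' = {}) \<longleftrightarrow> (\<forall>u\<in>H. \<forall>u'\<in>H. u \<noteq> u' \<longrightarrow>
      \<not> (b u = b u' \<and> a u \<le> a u' + l u' \<and> a u' \<le> a u + l u))"
    by (intro ball_cong refl) (simp only: hh)
  have 2: "(\<forall>v\<in>V. \<forall>v'\<in>V. v \<noteq> v' \<longrightarrow> S v \<inter> S v' = {}) \<longleftrightarrow> (\<forall>v\<in>V. \<forall>v'\<in>V. v \<noteq> v' \<longrightarrow>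
      \<not> (a v = a v' \<and> b v \<le> b v' + l v' \<and> b v' \<le> b v + l v))"
    by (intro ball_cong refl) (simp only: vv)
  have 3: "(\<forall>u\<in>H. \<forall>v\<in>V. S u \<inter> S v \<noteq> {} \<longleftrightarrow> (u, v) \<in> parcs G) \<longleftrightarrow>
      (\<forall>u\<in>H. \<forall>v\<in>V. (u, v) \<in> parcs G \<longleftrightarrow>
        a u \<le> a v \<and> a v \<le> a u + l u \<and> b v \<le> b u \<and> b u \<le> b v + l v)"
    by (intro ball_cong refl) (subst hv, assumption, assumption, rule eq_commute)
  show ?thesis
    unfolding grid_intersection_rep_def grid_coordinates_def 1 2 3
    by (insert h v pos) (intro iffI conjI; elim conjE; assumption)
qed

lemma grid_intersection_rep_coordinates:
  assumes rep: "grid_intersection_rep G H V S" and disjoint: "H \<inter> V = {}"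
  obtains a b l where "grid_coordinates G H V a b l"
    "\<forall>u\<in>H. horizontal_segment 1 (S u) \<longrightarrow> l u = 1"
    "\<forall>v\<in>V. vertical_segment 1 (S v) \<longrightarrow> l v = 1"
proof -
  have rep_H: "\<forall>u\<in>H. \<exists>l. horizontal_segment l (S u)"
    and rep_V: "\<forall>v\<in>V. \<exists>l. vertical_segment l (S v)"
    using rep unfolding grid_intersection_rep_def by - (elim conjE, assumption)+
  \<comment> \<open>One predicate for both orientations lets a single choice yield \<open>a\<close>,
    \<open>b\<close> and \<open>l\<close> on \<open>H \<union> V\<close>; disjointness makes the
    clause of the other orientation vacuous.\<close>
  define P where "P w x y l \<longleftrightarrow> l > 0 \<and>
      (w \<in> H \<longrightarrow> S w = {x..x + l} \<times> {y} \<and> (horizontal_segment 1 (S w) \<longrightarrow> l = 1)) \<and>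
      (w \<in> V \<longrightarrow> S w = {x} \<times> {y..y + l} \<and> (vertical_segment 1 (S w) \<longrightarrow> l = 1))" for w x y l
  have "\<exists>x y l. P w x y l" if "w \<in> H \<union> V" for w
  proof (cases "w \<in> H")
    case True
    then have "w \<notin> V"
      using disjoint by blast
    \<comment> \<open>The length is chosen to be 1 whenever 1 is possible, which avoids an argument
      that a segment determines its length.\<close>
    obtain l where l: "horizontal_segment l (S w)" "horizontal_segment 1 (S w) \<longrightarrow> l = 1"
      using rep_H True by blast
    from l(1) obtain x y where "l > 0" "S w = {x..x + l} \<times> {y}"
      unfolding horizontal_segment_iff by (elim conjE exE)
    then have "P w x y l"
      unfolding P_def using l(2) \<open>w \<notin> V\<close> by blast
    then show ?thesis
      by blast
  next
    case False
    then have "w \<in> V"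
      using that by blast
    obtain l where l: "vertical_segment l (S w)" "vertical_segment 1 (S w) \<longrightarrow> l = 1"
      using rep_V \<open>w \<in> V\<close> by blast
    from l(1) obtain x y where "l > 0" "S w = {x} \<times> {y..y + l}"
      unfolding vertical_segment_iff by (elim conjE exE)
    then have "P w x y l"
      unfolding P_def using l(2) False by blast
    then show ?thesis
      by blast
  qed
  then obtain a b l where P: "\<And>w. w \<in> H \<union> V \<Longrightarrow> P w (a w) (b w) (l w)"
    by metis
  have H: "l u > 0 \<and> S u = {a u..a u + l u} \<times> {b u} \<and> (horizontal_segment 1 (S u) \<longrightarrow> l u = 1)"
    if "u \<in> H" for u
    using P[of u] that unfolding P_def by blast
  have V: "l v > 0 \<and> S v = {a v} \<times> {b v..b v + l v} \<and> (vertical_segment 1 (S v) \<longrightarrow> l v = 1)"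
    if "v \<in> V" for v
    using P[of v] that unfolding P_def by blast
  show thesis
  proof
    have "grid_intersection_rep G H V S \<longleftrightarrow> grid_coordinates G H V a b l"
      by (rule grid_intersection_rep_iff) (blast dest: H V)+
    with rep show "grid_coordinates G H V a b l"
      by blast
  qed (blast dest: H V)+
qed

lemma grid_coordinates_rep:
  assumes "grid_coordinates G H V a b l" and disjoint: "H \<inter> V = {}"
  obtains S where "grid_intersection_rep G H V S"
    "\<forall>u\<in>H. horizontal_segment (l u) (S u)" "\<forall>v\<in>V. vertical_segment (l v) (S v)"
proof -
  define S where "S w = (if w \<in> H then {a w..a w + l w} \<times> {b w} else {a w} \<times> {b w..b w + l w})" for w
  have l: "\<forall>w\<in>H \<union> V. l w > 0"
    using assms(1) unfolding grid_coordinates_def by (rule conjunct1)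
  have H: "l u > 0 \<and> S u = {a u..a u + l u} \<times> {b u}" if "u \<in> H" for u
    using that l by (simp add: S_def)
  have V: "l v > 0 \<and> S v = {a v} \<times> {b v..b v + l v}" if "v \<in> V" for v
    using that l disjoint by (auto simp: S_def)
  show thesis
  proof
    show "grid_intersection_rep G H V S"
      by (rule iffD2[OF grid_intersection_rep_iff assms(1)]) (blast dest: H V)+
    show "\<forall>u\<in>H. horizontal_segment (l u) (S u)"
      using H unfolding horizontal_segment_iff by blast
    show "\<forall>v\<in>V. vertical_segment (l v) (S v)"
      using V unfolding vertical_segment_iff by blast
  qed
qed

text \<open>Reflection in the main diagonal: the two orientations and the two coordinates change
  places while lengths stay. Symmetry of the arcs lets the crossing condition be read from the other
  side.\<close>

lemma grid_coordinates_swap: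
  assumes "grid_coordinates G H V a b l" "\<And>u v. (u, v) \<in> parcs G \<Longrightarrow> (v, u) \<in> parcs G"
  shows "grid_coordinates G V H b a l"
proof -
  have 1: "\<forall>w\<in>H \<union> V. l w > 0"
    and 2: "\<forall>u\<in>H. \<forall>u'\<in>H. u \<noteq> u' \<longrightarrow> \<not> (b u = b u' \<and> a u \<le> a u' + l u' \<and> a u' \<le> a u + l u)"
    and 3: "\<forall>v\<in>V. \<forall>v'\<in>V. v \<noteq> v' \<longrightarrow> \<not> (a v = a v' \<and> b v \<le> b v' + l v' \<and> b v' \<le> b v + l v)"
    and 4: "\<forall>u\<in>H. \<forall>v\<in>V. (u, v) \<in> parcs G \<longleftrightarrow>
      a u \<le> a v \<and> a v \<le> a u + l u \<and> b v \<le> b u \<and> b u \<le> b v + l v"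
    using assms(1) unfolding grid_coordinates_def by - (elim conjE, assumption)+
  have sym: "(v, u) \<in> parcs G \<longleftrightarrow> (u, v) \<in> parcs G" for u v
    using assms(2) by blast
  have "\<forall>v\<in>V. \<forall>u\<in>H. (v, u) \<in> parcs G \<longleftrightarrow>
      b v \<le> b u \<and> b u \<le> b v + l v \<and> a u \<le> a v \<and> a v \<le> a u + l u"
  proof (intro ballI)
    fix v u
    assume "v \<in> V" "u \<in> H"
    then have "(v, u) \<in> parcs G \<longleftrightarrow>
        a u \<le> a v \<and> a v \<le> a u + l u \<and> b v \<le> b u \<and> b u \<le> b v + l v"
      unfolding sym[of v u] by (intro 4[rule_format])
    then show "(v, u) \<in> parcs G \<longleftrightarrow>
        b v \<le> b u \<and> b u \<le> b v + l v \<and> a u \<le> a v \<and> a v \<le> a u + l u"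
      by (simp only: conj_ac)
  qed
  moreover have "\<forall>w\<in>V \<union> H. l w > 0"
    using 1 by (simp only: Un_commute)
  ultimately show ?thesis
    unfolding grid_coordinates_def using 2 3 by - (intro conjI; assumption)
qed

lemma bipartition_disjoint: "bipartition G H V \<Longrightarrow> H \<inter> V = {}"
  by (simp add: bipartition_def)

lemma bipartition_swap: "bipartition G H V \<Longrightarrow> bipartition G V H"
  by (auto simp: bipartition_def)

lemma unit_grid_intersection_graph_iff:
  "unit_grid_intersection_graph G \<longleftrightarrow> (\<exists>H V a b l. bipartition G H V \<and>
     grid_coordinates G H V a b l \<and> (\<forall>u\<in>H. l u = 1) \<and> (\<forall>v\<in>V. l v = 1))"
proof
  assume "unit_grid_intersection_graph G"
  then obtain H V S where S: "bipartition G H V" "grid_intersection_rep G H V S"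
    "\<forall>u\<in>H. horizontal_segment 1 (S u)" "\<forall>v\<in>V. vertical_segment 1 (S v)"
    unfolding unit_grid_intersection_graph_def by blast
  obtain a b l where "grid_coordinates G H V a b l"
    "\<forall>u\<in>H. horizontal_segment 1 (S u) \<longrightarrow> l u = 1"
    "\<forall>v\<in>V. vertical_segment 1 (S v) \<longrightarrow> l v = 1"
    by (rule grid_intersection_rep_coordinates[OF S(2) bipartition_disjoint[OF S(1)]])
  moreover from this S have "\<forall>u\<in>H. l u = 1" "\<forall>v\<in>V. l v = 1"
    by simp_all
  ultimately show "\<exists>H V a b l. bipartition G H V \<and>
     grid_coordinates G H V a b l \<and> (\<forall>u\<in>H. l u = 1) \<and> (\<forall>v\<in>V. l v = 1)"
    using S(1) by blast
next
  assume "\<exists>H V a b l. bipartition G H V \<and>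
     grid_coordinates G H V a b l \<and> (\<forall>u\<in>H. l u = 1) \<and> (\<forall>v\<in>V. l v = 1)"
  then obtain H V a b l where *: "bipartition G H V" "grid_coordinates G H V a b l"
    "\<forall>u\<in>H. l u = 1" "\<forall>v\<in>V. l v = 1"
    by blast
  obtain S where "grid_intersection_rep G H V S"
    "\<forall>u\<in>H. horizontal_segment (l u) (S u)" "\<forall>v\<in>V. vertical_segment (l v) (S v)"
    by (rule grid_coordinates_rep[OF *(2) bipartition_disjoint[OF *(1)]])
  moreover from this * have "\<forall>u\<in>H. horizontal_segment 1 (S u)" "\<forall>v\<in>V. vertical_segment 1 (S v)"
    by simp_all
  ultimately show "unit_grid_intersection_graph G"
    unfolding unit_grid_intersection_graph_def using *(1) by blast
qed

lemma USEG_graph_iff: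
  assumes sym: "\<And>u v. (u, v) \<in> parcs G \<Longrightarrow> (v, u) \<in> parcs G"
  shows "USEG_graph G \<longleftrightarrow> (\<exists>H V a b l. bipartition G H V \<and>
     grid_coordinates G H V a b l \<and> (\<forall>u\<in>H. l u = 1))"
proof
  assume "USEG_graph G"
  then obtain H V S where S: "bipartition G H V" "grid_intersection_rep G H V S"
    "(\<forall>u\<in>H. horizontal_segment 1 (S u)) \<or> (\<forall>v\<in>V. vertical_segment 1 (S v))"
    unfolding USEG_graph_def by blast
  obtain a b l where l: "grid_coordinates G H V a b l"
    "\<forall>u\<in>H. horizontal_segment 1 (S u) \<longrightarrow> l u = 1"
    "\<forall>v\<in>V. vertical_segment 1 (S v) \<longrightarrow> l v = 1"
    by (rule grid_intersection_rep_coordinates[OF S(2) bipartition_disjoint[OF S(1)]])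
  from S(3) show "\<exists>H V a b l. bipartition G H V \<and> grid_coordinates G H V a b l \<and> (\<forall>u\<in>H. l u = 1)"
  proof
    assume "\<forall>u\<in>H. horizontal_segment 1 (S u)"
    then have "\<forall>u\<in>H. l u = 1"
      using l(2) by blast
    with S(1) l(1) show ?thesis
      by blast
  next
    assume "\<forall>v\<in>V. vertical_segment 1 (S v)"
    then have "\<forall>v\<in>V. l v = 1"
      using l(3) by blast
    with bipartition_swap[OF S(1)] grid_coordinates_swap[OF l(1) sym] show ?thesis
      by blast
  qed
next
  assume "\<exists>H V a b l. bipartition G H V \<and> grid_coordinates G H V a b l \<and> (\<forall>u\<in>H. l u = 1)"
  then obtain H V a b l where *: "bipartition G H V" "grid_coordinates G H V a b l"
    "\<forall>u\<in>H. l u = 1"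
    by blast
  obtain S where "grid_intersection_rep G H V S"
    "\<forall>u\<in>H. horizontal_segment (l u) (S u)" "\<forall>v\<in>V. vertical_segment (l v) (S v)"
    by (rule grid_coordinates_rep[OF *(2) bipartition_disjoint[OF *(1)]])
  moreover from this * have "\<forall>u\<in>H. horizontal_segment 1 (S u)"
    by simp
  ultimately show "USEG_graph G"
    unfolding USEG_graph_def using *(1) by blast
qed

section \<open>Rounding to small integer coordinates\<close>

lemma card_below_le_iff:
  fixes T :: "'a :: linorder set"
  assumes "finite T" "t \<in> T" "u \<in> T"
  shows "card (T \<inter> {..<t}) \<le> card (T \<inter> {..<u}) \<longleftrightarrow> t \<le> u"
proof
  assume "t \<le> u"
  then have "T \<inter> {..<t} \<subseteq> T \<inter> {..<u}"
    by auto
  then show "card (T \<inter> {..<t}) \<le> card (T \<inter> {..<u})"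
    by (rule card_mono[rotated]) (simp add: assms(1))
next
  assume le: "card (T \<inter> {..<t}) \<le> card (T \<inter> {..<u})"
  show "t \<le> u"
  proof (rule ccontr)
    assume "\<not> t \<le> u"
    then have "T \<inter> {..<u} \<subseteq> T \<inter> {..<t}" "u \<in> T \<inter> {..<t}" "u \<notin> T \<inter> {..<u}"
      using assms(3) by auto
    then have "T \<inter> {..<u} \<subset> T \<inter> {..<t}"
      by blast
    then have "card (T \<inter> {..<u}) < card (T \<inter> {..<t})"
      by (rule psubset_card_mono[rotated]) (simp add: assms(1))
    with le show False
      by simp
  qed
qed

text \<open>The rank of \<open>e i\<close> among all \<open>e k\<close> and \<open>e k + 1\<close> closes every gap longer than 2.\<close>

lemma int_gap_compression:
  fixes e :: "nat \<Rightarrow> int"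
  shows "\<exists>d :: nat \<Rightarrow> nat. (\<forall>i<n. d i \<le> 2 * n) \<and>
    (\<forall>i<n. \<forall>j<n. (d i \<le> d j \<longleftrightarrow> e i \<le> e j) \<and> (d i \<le> d j + 1 \<longleftrightarrow> e i \<le> e j + 1))"
proof -
  define T where "T = e ` {..<n} \<union> (\<lambda>k. e k + 1) ` {..<n}"
  define d where "d i = card (T \<inter> {..<e i})" for i
  have fin: "finite T"
    by (simp add: T_def)
  have "card T \<le> card (e ` {..<n}) + card ((\<lambda>k. e k + 1) ` {..<n})"
    unfolding T_def by (rule card_Un_le)
  also have "\<dots> \<le> n + n"
    using card_image_le[of "{..<n}" e] card_image_le[of "{..<n}" "\<lambda>k. e k + 1"]
    by (intro add_mono) simp_all
  finally have "card T \<le> 2 * n"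
    by simp
  moreover have "d i \<le> card T" for i
    unfolding d_def by (rule card_mono[OF fin]) simp
  ultimately have 1: "d i \<le> 2 * n" for i
    by (meson le_trans)
  have 2: "d i \<le> d j \<longleftrightarrow> e i \<le> e j" if "i < n" "j < n" for i j
    unfolding d_def using that by (intro card_below_le_iff fin) (auto simp: T_def)
  have 3: "d i \<le> d j + 1 \<longleftrightarrow> e i \<le> e j + 1" if "i < n" "j < n" for i j
  proof -
    have T: "e i \<in> T" "e j \<in> T" "e j + 1 \<in> T"
      using that by (auto simp: T_def)
    \<comment> \<open>Integrality enters here: no element of \<open>T\<close> lies strictly between
      \<open>e j\<close> and \<open>e j + 1\<close>, so the rank grows by exactly 1.\<close>
    then have "T \<inter> {..<e j + 1} = insert (e j) (T \<inter> {..<e j})"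
      by auto
    then have "card (T \<inter> {..<e j + 1}) = d j + 1"
      using fin by (simp add: d_def)
    then show ?thesis
      using card_below_le_iff[OF fin T(1,3)] by (simp add: d_def)
  qed
  show ?thesis
    by (intro exI[of _ d] conjI allI impI 1 2 3)
qed

text \<open>Low digits below the base \<open>n\<close> cause no carry. This is the integer
  counterpart of comparing reals by floor and then by fractional part.\<close>

lemma mult_add_le_iff:
  fixes a b n r s :: nat
  assumes "r < n" "s < n"
  shows "n * a + r \<le> n * b + s \<longleftrightarrow> a < b \<or> a = b \<and> r \<le> s"
proof -
  have less: "n * a + r < n * b + s" if "a < b" "r < n" for a b r s
  proof -
    have "n * a + n \<le> n * b"
      using mult_le_mono2[of "Suc a" b n] that(1) by simp
    then show ?thesis
      using that(2) by linarith
  qed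
  show ?thesis
    using less[of a b r s] less[of b a s r] assms by (cases a b rule: linorder_cases) auto
qed

lemma le_iff_floor_frac: "x \<le> y \<longleftrightarrow> \<lfloor>x\<rfloor> < \<lfloor>y\<rfloor> \<or> \<lfloor>x\<rfloor> = \<lfloor>y\<rfloor> \<and> frac x \<le> frac y" for x y :: real
  unfolding frac_def by linarith

text \<open>\<open>F\<close> is a two-digit number in base \<open>n\<close>: the compressed floor is
  the high digit, the rank of the fractional part the low one. The high digit contributes at most
  \<open>2 * n * n\<close>, the low one less than \<open>n\<close>, hence at most
  \<open>n * n\<close>.\<close>

lemma unit_order_compression:
  fixes f :: "nat \<Rightarrow> real"
  shows "\<exists>F :: nat \<Rightarrow> nat. (\<forall>i<n. F i \<le> 3 * n * n) \<and>
    (\<forall>i<n. \<forall>j<n. (F i \<le> F j \<longleftrightarrow> f i \<le> f j) \<and> (F i \<le> F j + n \<longleftrightarrow> f i \<le> f j + 1))"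
proof -
  obtain d :: "nat \<Rightarrow> nat" where "(\<forall>i<n. d i \<le> 2 * n) \<and> (\<forall>i<n. \<forall>j<n.
      (d i \<le> d j \<longleftrightarrow> \<lfloor>f i\<rfloor> \<le> \<lfloor>f j\<rfloor>) \<and> (d i \<le> d j + 1 \<longleftrightarrow> \<lfloor>f i\<rfloor> \<le> \<lfloor>f j\<rfloor> + 1))"
    using int_gap_compression by (rule exE)
  then have d: "\<And>i. i < n \<Longrightarrow> d i \<le> 2 * n"
    "\<And>i j. i < n \<Longrightarrow> j < n \<Longrightarrow> d i \<le> d j \<longleftrightarrow> \<lfloor>f i\<rfloor> \<le> \<lfloor>f j\<rfloor>"
    "\<And>i j. i < n \<Longrightarrow> j < n \<Longrightarrow> d i \<le> d j + 1 \<longleftrightarrow> \<lfloor>f i\<rfloor> \<le> \<lfloor>f j\<rfloor> + 1"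
    by simp_all
  define T where "T = (\<lambda>i. frac (f i)) ` {..<n}"
  define r where "r i = card (T \<inter> {..<frac (f i)})" for i
  define F where "F i = n * d i + r i" for i
  have fin: "finite T"
    by (simp add: T_def)
  have rle: "r i \<le> r j \<longleftrightarrow> frac (f i) \<le> frac (f j)" if "i < n" "j < n" for i j
    unfolding r_def using that by (intro card_below_le_iff fin) (auto simp: T_def)
  have rn: "r i < n" if "i < n" for i
  proof -
    have "frac (f i) \<in> T"
      using that by (simp add: T_def)
    then have "T \<inter> {..<frac (f i)} \<subset> T"
      by blast
    then have "r i < card T"
      unfolding r_def by (intro psubset_card_mono fin)
    also have "\<dots> \<le> n"
      using card_image_le[of "{..<n}" "\<lambda>i. frac (f i)"] by (simp add: T_def)
    finally show ?thesis .
  qed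
  have 1: "F i \<le> 3 * n * n" if "i < n" for i
  proof -
    have "F i \<le> n * (2 * n) + n * 1"
      unfolding F_def using d(1)[OF that] rn[OF that] by (intro add_mono mult_le_mono2) simp_all
    also have "\<dots> \<le> n * (2 * n) + n * n"
      using that by (intro add_left_mono mult_le_mono2) simp
    finally show ?thesis
      by simp
  qed
  have 2: "F i \<le> F j \<longleftrightarrow> f i \<le> f j" if "i < n" "j < n" for i j
  proof -
    have "d i < d j \<longleftrightarrow> \<lfloor>f i\<rfloor> < \<lfloor>f j\<rfloor>"
      using d(2)[OF that(2,1)] by linarith
    moreover have "d i = d j \<longleftrightarrow> \<lfloor>f i\<rfloor> = \<lfloor>f j\<rfloor>"
      using d(2)[OF that] d(2)[OF that(2,1)] by linarith
    ultimately show ?thesis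
      by (simp only: F_def mult_add_le_iff[OF rn[OF that(1)] rn[OF that(2)]]
          le_iff_floor_frac[of "f i"] rle[OF that])
  qed
  have 3: "F i \<le> F j + n \<longleftrightarrow> f i \<le> f j + 1" if "i < n" "j < n" for i j
  proof -
    have "F i \<le> F j + n \<longleftrightarrow> d i < d j + 1 \<or> d i = d j + 1 \<and> r i \<le> r j"
      using mult_add_le_iff[OF rn[OF that(1)] rn[OF that(2)], of "d i" "d j + 1"]
      by (simp add: F_def algebra_simps)
    also have "d i < d j + 1 \<longleftrightarrow> \<lfloor>f i\<rfloor> < \<lfloor>f j\<rfloor> + 1"
      using d(2)[OF that] by linarith
    \<comment> \<open>Equality is read off from two comparisons: \<open>d i\<close> is at most
      \<open>d j + 1\<close> but not at most \<open>d j\<close>.\<close>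
    also have "d i = d j + 1 \<longleftrightarrow> \<lfloor>f i\<rfloor> = \<lfloor>f j\<rfloor> + 1"
      using d(2,3)[OF that] by linarith
    also have "\<lfloor>f i\<rfloor> < \<lfloor>f j\<rfloor> + 1 \<or> \<lfloor>f i\<rfloor> = \<lfloor>f j\<rfloor> + 1 \<and> r i \<le> r j \<longleftrightarrow> \<lfloor>f i\<rfloor> < \<lfloor>f j + 1\<rfloor> \<or> \<lfloor>f i\<rfloor> = \<lfloor>f j + 1\<rfloor> \<and> frac (f i) \<le> frac (f j + 1)"
      by (simp only: frac_1_eq one_add_floor rle[OF that])
    finally show ?thesis
      by (simp only: le_iff_floor_frac[of "f i" "f j + 1"])
  qed
  show ?thesis
    by (intro exI[of _ F] conjI allI impI 1 2 3)
qed

lemma consistentD: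
  assumes "consistent unit n A s X Y Z i j"
  shows "A i j \<longleftrightarrow> A j i"
    and "A i j \<Longrightarrow> s i = 0 \<longleftrightarrow> s j \<noteq> 0"
    and "s i = 0 \<Longrightarrow> s j \<noteq> 0 \<Longrightarrow>
      A i j \<longleftrightarrow> X i \<le> X j \<and> X j \<le> X i + n \<and> Y j \<le> Y i \<and> Y i \<le> Z j"
    and "s i = 0 \<Longrightarrow> s j = 0 \<Longrightarrow> i \<noteq> j \<Longrightarrow> \<not> (Y i = Y j \<and> X i \<le> X j + n \<and> X j \<le> X i + n)"
    and "s i \<noteq> 0 \<Longrightarrow> s j \<noteq> 0 \<Longrightarrow> i \<noteq> j \<Longrightarrow> \<not> (X i = X j \<and> Y i \<le> Z j \<and> Y j \<le> Z i)"
    and "s i \<noteq> 0 \<Longrightarrow> Y i < Z i"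
    and "s i \<noteq> 0 \<Longrightarrow> unit \<Longrightarrow> Z i = Y i + n"
  using assms unfolding consistent_def by blast+

text \<open>Division by \<open>n\<close> turns the integer unit into length 1. Horizontal segments
  receive this length, and vertical ones the length given by the difference of \<open>Z\<close> and
  \<open>Y\<close>.\<close>

lemma consistent_imp_coordinates:
  assumes verts: "pverts G = {..<n}" and arcs: "parcs G \<subseteq> {..<n} \<times> {..<n}"
    and A: "\<And>i j. i < n \<Longrightarrow> j < n \<Longrightarrow> A i j \<longleftrightarrow> (i, j) \<in> parcs G"
    and con: "\<And>i j. i < n \<Longrightarrow> j < n \<Longrightarrow> consistent unit n A s X Y Z i j"
  obtains H V a b l where "bipartition G H V" "grid_coordinates G H V a b l"
    "\<forall>u\<in>H. l u = 1" "unit \<longrightarrow> (\<forall>v\<in>V. l v = 1)"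
proof -
  define H V where "H = {i \<in> {..<n}. s i = 0}" and "V = {i \<in> {..<n}. s i \<noteq> 0}"
  define a b l where "a i = X i / n" and "b i = Y i / n"
    and "l i = (if s i = 0 then 1 else (real (Z i) - real (Y i)) / n)" for i
  have H: "i \<in> H \<longleftrightarrow> i < n \<and> s i = 0" and V: "i \<in> V \<longleftrightarrow> i < n \<and> s i \<noteq> 0" for i
    by (simp_all add: H_def V_def)
  have a: "a i \<le> a j \<longleftrightarrow> X i \<le> X j" "a i = a j \<longleftrightarrow> X i = X j" "a i \<le> a j + 1 \<longleftrightarrow> X i \<le> X j + n"
    if "n > 0" for i j
  proof -
    show "a i \<le> a j \<longleftrightarrow> X i \<le> X j"
      using that by (simp add: a_def divide_le_cancel)
    show "a i = a j \<longleftrightarrow> X i = X j"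
      using that by (simp add: a_def)
    have "a j + 1 = real (X j + n) / n"
      using that by (simp add: a_def add_divide_distrib)
    then have "a i \<le> a j + 1 \<longleftrightarrow> real (X i) / n \<le> real (X j + n) / n"
      by (simp only: a_def[of i])
    also have "\<dots> \<longleftrightarrow> real (X i) \<le> real (X j + n)"
      using that by (simp add: divide_le_cancel)
    finally show "a i \<le> a j + 1 \<longleftrightarrow> X i \<le> X j + n"
      by (simp only: of_nat_le_iff)
  qed
  have b: "b i \<le> b j \<longleftrightarrow> Y i \<le> Y j" "b i = b j \<longleftrightarrow> Y i = Y j"
    if "n > 0" for i j
    using that by (simp_all add: b_def divide_le_cancel)
  have bl: "b i \<le> b j + l j \<longleftrightarrow> Y i \<le> Z j" if "j \<in> V" for i j
  proof -
    have "b j + l j = real (Z j) / n"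
      using that by (simp add: b_def l_def V add_divide_distrib[symmetric])
    then have "b i \<le> b j + l j \<longleftrightarrow> real (Y i) / n \<le> real (Z j) / n"
      by (simp only: b_def[of i])
    also have "\<dots> \<longleftrightarrow> Y i \<le> Z j"
      using that by (simp add: V divide_le_cancel)
    finally show ?thesis .
  qed
  have lH: "l i = 1" if "i \<in> H" for i
    using that by (simp add: H l_def)
  show thesis
  proof
    show "bipartition G H V"
      unfolding bipartition_def
    proof (intro conjI ballI)
      show "H \<union> V = pverts G" "H \<inter> V = {}"
        by (auto simp: H V verts)
      fix e
      assume "e \<in> parcs G"
      then obtain u v where e: "e = (u, v)" "u < n" "v < n" "(u, v) \<in> parcs G"
        using arcs by (cases e) auto
      then have "s u = 0 \<longleftrightarrow> s v \<noteq> 0"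
        using consistentD(2)[OF con] A by blast
      then show "case e of (u, v) \<Rightarrow> u \<in> H \<and> v \<in> V \<or> u \<in> V \<and> v \<in> H"
        using e by (auto simp: H V)
    qed
    show "grid_coordinates G H V a b l"
      unfolding grid_coordinates_def
    proof (intro conjI ballI impI)
      fix w
      assume "w \<in> H \<union> V"
      \<comment> \<open>Conditions on a single vertex are part of the pair test, so they are taken
        from its diagonal.\<close>
      then show "l w > 0"
        using consistentD(6)[OF con[of w w]] by (auto simp: H V l_def)
    next
      fix u u'
      assume "u \<in> H" "u' \<in> H" "u \<noteq> u'"
      \<comment> \<open>The facts about quotients by \<open>n\<close> presuppose
        \<open>n > 0\<close>, which the existence of a vertex provides.\<close>
      moreover from this have "n > 0"
        by (simp add: H V)
      ultimately show "\<not> (b u = b u' \<and> a u \<le> a u' + l u' \<and> a u' \<le> a u + l u)"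
        using consistentD(4)[OF con[of u u']] by (simp add: H lH[unfolded H] a b)
    next
      fix v v'
      assume "v \<in> V" "v' \<in> V" "v \<noteq> v'"
      moreover from this have "n > 0"
        by (simp add: H V)
      ultimately show "\<not> (a v = a v' \<and> b v \<le> b v' + l v' \<and> b v' \<le> b v + l v)"
        using consistentD(5)[OF con[of v v']] by (simp add: V bl[unfolded V] a b)
    next
      fix u v
      assume "u \<in> H" "v \<in> V"
      moreover from this have "n > 0"
        by (simp add: H V)
      ultimately show "(u, v) \<in> parcs G \<longleftrightarrow>
          a u \<le> a v \<and> a v \<le> a u + l u \<and> b v \<le> b u \<and> b u \<le> b v + l v"
        using consistentD(3)[OF con[of u v]] A[of u v]
        by (simp add: H V lH[unfolded H] bl[unfolded V] a b)
    qed
    show "\<forall>u\<in>H. l u = 1"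
      using lH by blast
    show "unit \<longrightarrow> (\<forall>v\<in>V. l v = 1)"
    proof (intro impI ballI)
      fix v
      assume "unit" "v \<in> V"
      then show "l v = 1"
        using consistentD(7)[OF con[of v v]] by (simp add: V l_def)
    qed
  qed
qed

text \<open>The constant 12 is 3 times 2 times 2: it stems from vertical segments of free length,
  where the bound \<open>3 * n * n\<close> is applied to twice as many reals.\<close>

lemma coordinates_imp_consistent:
  assumes verts: "pverts G = {..<n}" and sym: "\<And>u v. (u, v) \<in> parcs G \<Longrightarrow> (v, u) \<in> parcs G"
    and A: "\<And>i j. i < n \<Longrightarrow> j < n \<Longrightarrow> A i j \<longleftrightarrow> (i, j) \<in> parcs G"
    and bip: "bipartition G H V" and coord: "grid_coordinates G H V a b l"
    and lH: "\<forall>u\<in>H. l u = 1" and lV: "unit \<longrightarrow> (\<forall>v\<in>V. l v = 1)"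
  obtains s X Y Z where "\<forall>i<n. s i \<le> 12 * (n * n) \<and> X i \<le> 12 * (n * n) \<and> Y i \<le> 12 * (n * n) \<and> Z i \<le> 12 * (n * n)"
    "\<forall>i<n. \<forall>j<n. consistent unit n A s X Y Z i j"
proof -
  have HV: "i \<in> H \<longleftrightarrow> i < n \<and> i \<notin> V" for i
    using bip verts unfolding bipartition_def by blast
  have arc: "i \<in> H \<longleftrightarrow> j \<in> V" if "(i, j) \<in> parcs G" "i < n" "j < n" for i j
    using bip that HV unfolding bipartition_def by blast
  have pos: "\<forall>w\<in>H \<union> V. l w > 0"
    and hh: "\<forall>u\<in>H. \<forall>u'\<in>H. u \<noteq> u' \<longrightarrow> \<not> (b u = b u' \<and> a u \<le> a u' + l u' \<and> a u' \<le> a u + l u)"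
    and vv: "\<forall>v\<in>V. \<forall>v'\<in>V. v \<noteq> v' \<longrightarrow> \<not> (a v = a v' \<and> b v \<le> b v' + l v' \<and> b v' \<le> b v + l v)"
    and hv: "\<forall>u\<in>H. \<forall>v\<in>V. (u, v) \<in> parcs G \<longleftrightarrow>
      a u \<le> a v \<and> a v \<le> a u + l u \<and> b v \<le> b u \<and> b u \<le> b v + l v"
    using coord unfolding grid_coordinates_def by - (elim conjE, assumption)+
  obtain X :: "nat \<Rightarrow> nat" where "(\<forall>i<n. X i \<le> 3 * n * n) \<and>
      (\<forall>i<n. \<forall>j<n. (X i \<le> X j \<longleftrightarrow> a i \<le> a j) \<and> (X i \<le> X j + n \<longleftrightarrow> a i \<le> a j + 1))"
    using unit_order_compression by (rule exE)
  then have X: "X i \<le> 3 * n * n" "X i \<le> X j \<longleftrightarrow> a i \<le> a j" "X i \<le> X j + n \<longleftrightarrow> a i \<le> a j + 1"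
    if "i < n" "j < n" for i j
    using that by simp_all
  have "\<exists>Y Z :: nat \<Rightarrow> nat. \<forall>i<n. Y i \<le> 12 * (n * n) \<and> Z i \<le> 12 * (n * n) \<and>
      (\<forall>j<n. (Y i \<le> Y j \<longleftrightarrow> b i \<le> b j) \<and> (j \<in> V \<longrightarrow> (Y i \<le> Z j \<longleftrightarrow> b i \<le> b j + l j))) \<and>
      (i \<in> V \<longrightarrow> Y i < Z i \<and> (unit \<longrightarrow> Z i = Y i + n))"
  proof (cases "unit")
    case True
    \<comment> \<open>For unit segments the upper end has to be \<open>Y i + n\<close>, and its
      comparisons are those with \<open>b j + 1\<close> that the compression preserves.\<close>
    obtain Y :: "nat \<Rightarrow> nat" where "(\<forall>i<n. Y i \<le> 3 * n * n) \<and>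
        (\<forall>i<n. \<forall>j<n. (Y i \<le> Y j \<longleftrightarrow> b i \<le> b j) \<and> (Y i \<le> Y j + n \<longleftrightarrow> b i \<le> b j + 1))"
      using unit_order_compression by (rule exE)
    then have Y: "Y i \<le> 3 * n * n" "Y i \<le> Y j \<longleftrightarrow> b i \<le> b j" "Y i \<le> Y j + n \<longleftrightarrow> b i \<le> b j + 1"
      if "i < n" "j < n" for i j
      using that by simp_all
    have Yn: "Y i + n \<le> 12 * (n * n)" if "i < n" for i
    proof -
      have "n * 1 \<le> n * n"
        using that by (intro mult_le_mono2) simp
      then show ?thesis
        using Y(1)[OF that that] unfolding mult.assoc by linarith
    qed
    show ?thesis
    proof (rule exI[of _ Y], rule exI[of _ "\<lambda>i. Y i + n"], intro allI conjI impI)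
      fix i j
      assume i: "i < n"
      show "Y i \<le> 12 * (n * n)" "Y i + n \<le> 12 * (n * n)"
        using Yn[OF i] by linarith+
      show "Y i \<le> Y j \<longleftrightarrow> b i \<le> b j" if "j < n"
        using Y(2) i that by blast
      show "Y i \<le> Y j + n \<longleftrightarrow> b i \<le> b j + l j" if "j < n" "j \<in> V"
        using Y(3)[OF i that(1)] lV True that(2) by simp
      show "Y i < Y i + n" "Y i + n = Y i + n"
        using i by simp_all
    qed
  next
    case False
    \<comment> \<open>Upper ends have to stay comparable with lower ones, so both are compressed as
      one family of \<open>2 * n\<close> reals, with the upper end of vertex \<open>k\<close> at
      index \<open>n + k\<close>.\<close>
    define f where "f k = (if k < n then b k else b (k - n) + l (k - n))" for k
    obtain F :: "nat \<Rightarrow> nat" where "(\<forall>i<2 * n. F i \<le> 3 * (2 * n) * (2 * n)) \<and>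
        (\<forall>i<2 * n. \<forall>j<2 * n. (F i \<le> F j \<longleftrightarrow> f i \<le> f j) \<and> (F i \<le> F j + 2 * n \<longleftrightarrow> f i \<le> f j + 1))"
      using unit_order_compression by (rule exE)
    then have F: "F i \<le> 12 * (n * n)" "F i \<le> F j \<longleftrightarrow> f i \<le> f j" if "i < 2 * n" "j < 2 * n" for i j
      using that by simp_all
    show ?thesis
    proof (rule exI[of _ F], rule exI[of _ "\<lambda>i. F (n + i)"], intro allI conjI impI)
      fix i j
      assume i: "i < n"
      show "F i \<le> 12 * (n * n)" "F (n + i) \<le> 12 * (n * n)"
        using F(1)[of i i] F(1)[of "n + i" i] i by simp_all
      show "F i \<le> F j \<longleftrightarrow> b i \<le> b j" if "j < n"
        using F(2)[of i j] i that by (simp add: f_def)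
      show "F i \<le> F (n + j) \<longleftrightarrow> b i \<le> b j + l j" if "j < n"
        using F(2)[of i "n + j"] i that by (simp add: f_def)
      show "F i < F (n + i)" if "i \<in> V"
        using F(2)[of "n + i" i] i pos that by (auto simp: f_def not_le[symmetric])
      show "F (n + i) = F i + n" if "unit"
        using that False by simp
    qed
  qed
  then obtain Y Z where YZ: "\<forall>i<n. Y i \<le> 12 * (n * n) \<and> Z i \<le> 12 * (n * n) \<and>
      (\<forall>j<n. (Y i \<le> Y j \<longleftrightarrow> b i \<le> b j) \<and> (j \<in> V \<longrightarrow> (Y i \<le> Z j \<longleftrightarrow> b i \<le> b j + l j))) \<and>
      (i \<in> V \<longrightarrow> Y i < Z i \<and> (unit \<longrightarrow> Z i = Y i + n))"
    by (elim exE)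
  then have Y: "Y i \<le> Y j \<longleftrightarrow> b i \<le> b j" "j \<in> V \<Longrightarrow> Y i \<le> Z j \<longleftrightarrow> b i \<le> b j + l j"
    "i \<in> V \<Longrightarrow> Y i < Z i" "i \<in> V \<Longrightarrow> unit \<Longrightarrow> Z i = Y i + n" if "i < n" "j < n" for i j
    using that by simp_all
  define s :: "nat \<Rightarrow> nat" where "s i = of_bool (i \<in> V)" for i
  have sH: "s i = 0 \<longleftrightarrow> i \<in> H" and sV: "s i \<noteq> 0 \<longleftrightarrow> i \<in> V" if "i < n" for i
    using HV that by (simp_all add: s_def)
  show thesis
  proof
    show "\<forall>i<n. s i \<le> 12 * (n * n) \<and> X i \<le> 12 * (n * n) \<and> Y i \<le> 12 * (n * n) \<and> Z i \<le> 12 * (n * n)"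
    proof (intro allI impI conjI)
      fix i
      assume i: "i < n"
      then have "1 \<le> n * n"
        by (simp add: Suc_le_eq)
      moreover have "s i \<le> 1"
        by (simp add: s_def)
      ultimately show "s i \<le> 12 * (n * n)"
        by linarith
      show "X i \<le> 12 * (n * n)"
        using X(1)[OF i i] by linarith
      show "Y i \<le> 12 * (n * n)" "Z i \<le> 12 * (n * n)"
        using YZ i by blast+
    qed
    show "\<forall>i<n. \<forall>j<n. consistent unit n A s X Y Z i j"
    proof (intro allI impI)
      fix i j
      assume i: "i < n" and j: "j < n"
      note Xij = X(2,3)[OF i j] X(2,3)[OF j i] and Yij = Y(1,2)[OF i j] Y(1,2)[OF j i]
      have Xeq: "X i = X j \<longleftrightarrow> a i = a j"
        using Xij by (metis antisym order_refl)
      have Yeq: "Y i = Y j \<longleftrightarrow> b i = b j"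
        using Yij by (metis antisym order_refl)
      have 1: "A i j \<longleftrightarrow> A j i"
        using A i j sym by blast
      have 2: "s i = 0 \<longleftrightarrow> \<not> s j = 0" if "A i j"
        using arc[of i j] A i j that sH sV by blast
      have 3: "A i j \<longleftrightarrow> X i \<le> X j \<and> X j \<le> X i + n \<and> Y j \<le> Y i \<and> Y i \<le> Z j"
        if "s i = 0" "\<not> s j = 0"
      proof -
        have "i \<in> H" "j \<in> V"
          using that sH sV i j by blast+
        then show ?thesis
          using hv lH A[OF i j] Xij Yij by simp
      qed
      have 4: "\<not> (Y i = Y j \<and> X i \<le> X j + n \<and> X j \<le> X i + n)"
        if "s i = 0" "s j = 0" "\<not> i = j"
      proof -
        have "i \<in> H" "j \<in> H"
          using that sH i j by blast+
        then have "\<not> (b i = b j \<and> a i \<le> a j + l j \<and> a j \<le> a i + l i)" "l i = 1" "l j = 1"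
          using hh lH that by blast+
        then show ?thesis
          by (simp only: Xij Yeq simp_thms)
      qed
      have 5: "\<not> (X i = X j \<and> Y i \<le> Z j \<and> Y j \<le> Z i)"
        if "\<not> s i = 0" "\<not> s j = 0" "\<not> i = j"
      proof -
        have "i \<in> V" "j \<in> V"
          using that sV i j by blast+
        moreover from this have "\<not> (a i = a j \<and> b i \<le> b j + l j \<and> b j \<le> b i + l i)"
          using vv that by blast
        ultimately show ?thesis
          by (simp only: Yij Xeq simp_thms)
      qed
      have 6: "Y i < Z i \<and> (unit \<longrightarrow> Z i = Y i + n)" if "\<not> s i = 0"
        using Y(3,4)[OF i i] that sV[OF i] by blast
      show "consistent unit n A s X Y Z i j"
        unfolding consistent_def using 1 2 3 4 5 6 by blast
    qed
  qed
qed

section \<open>Adjacency matrices and certificates as bit strings\<close>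

lemma length_rows: "length (concat (map (\<lambda>i. map (f i) [0..<m]) [0..<n])) = n * m"
  by (induction n) simp_all

lemma nth_rows:
  assumes "i < n" "j < m"
  shows "concat (map (\<lambda>i. map (f i) [0..<m]) [0..<n]) ! (m * i + j) = f i j"
  using assms(1)
proof (induction n)
  case (Suc n)
  show ?case
  proof (cases "i = n")
    case True
    then show ?thesis
      using assms(2) by (simp add: nth_append length_rows mult.commute)
  next
    case False
    then have "i < n"
      using Suc.prems by simp
    have "m * i + j < m * Suc i"
      using assms(2) by simp
    also have "\<dots> \<le> m * n"
      using \<open>i < n\<close> by (intro mult_le_mono2) simp
    finally show ?thesis
      using Suc.IH[OF \<open>i < n\<close>] by (simp add: nth_append length_rows mult.commute)
  qed
qed simp

lemma length_adjacency_code: "pverts G = {..<n} \<Longrightarrow> length (adjacency_code G) = n * n"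
  by (simp add: adjacency_code_def Let_def length_rows)

lemma index_less: "i < n \<Longrightarrow> j < n \<Longrightarrow> n * i + j < n * n" for n :: nat
  using mult_le_mono2[of "Suc i" n n] by simp

lemma read_bit_adjacency_code:
  assumes "pverts G = {..<n}" "i < n" "j < n"
  shows "read_bit (adjacency_code G) (n * i + j) = 1 \<longleftrightarrow> (i, j) \<in> parcs G"
proof -
  have "adjacency_code G ! (n * i + j) \<longleftrightarrow> (i, j) \<in> parcs G"
    using assms by (simp add: adjacency_code_def Let_def nth_rows)
  then show ?thesis
    using index_less[OF assms(2,3)] by (simp add: read_bit_def length_adjacency_code[OF assms(1)])
qed

lemma adjacency_code_eqI:
  assumes "pverts G = {..<n}" "length x = n * n"
    and "\<And>i j. i < n \<Longrightarrow> j < n \<Longrightarrow> read_bit x (n * i + j) = 1 \<longleftrightarrow> (i, j) \<in> parcs G"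
  shows "x = adjacency_code G"
proof (rule nth_equalityI)
  show "length x = length (adjacency_code G)"
    by (simp only: assms(2) length_adjacency_code[OF assms(1)])
  fix k
  assume k: "k < length x"
  then have kn: "k < n * n"
    by (simp only: assms(2))
  then have "k div n < n"
    by (rule less_mult_imp_div_less)
  moreover have "k mod n < n"
    using kn by (cases n) simp_all
  moreover have "n * (k div n) + k mod n = k"
    by simp
  ultimately have "read_bit x k = 1 \<longleftrightarrow> read_bit (adjacency_code G) k = 1"
    using assms(3)[of "k div n" "k mod n"] read_bit_adjacency_code[OF assms(1), of "k div n" "k mod n"]
    by simp
  then show "x ! k = adjacency_code G ! k"
    using k kn by (cases "x ! k"; cases "adjacency_code G ! k")
      (simp_all add: read_bit_def length_adjacency_code[OF assms(1)])
qed

text \<open>Field \<open>q\<close> occupies positions \<open>w * q + 1\<close> to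
  \<open>w * q + w\<close>, whence the quotient and remainder of \<open>p - 1\<close>. The unary
  header fills position 0 and the slot of field 0, so \<open>N\<close> slots carry
  \<open>N - 1\<close> numbers.\<close>

definition certificate :: "nat \<Rightarrow> nat \<Rightarrow> (nat \<Rightarrow> nat) \<Rightarrow> bool list" where
  "certificate w N v = map (\<lambda>p. if p < w then True else if p = w then False
     else odd (v ((p - 1) div w) div 2 ^ (w - Suc ((p - 1) mod w)))) [0..<N * w + 1]"

lemma length_certificate: "length (certificate w N v) = N * w + 1"
  by (simp add: certificate_def)

lemma field_width_certificate:
  assumes "N > 0"
  shows "field_width (certificate w N v) = w"
proof -
  have len: "w < N * w + 1"
    using assms by (cases N) simp_all
  show ?thesis
    unfolding field_width_def
  proof (rule Least_equality)
    show "read_bit (certificate w N v) w \<noteq> 1"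
      using len by (simp add: read_bit_def certificate_def del: upt_Suc)
    fix k
    assume "read_bit (certificate w N v) k \<noteq> 1"
    then show "w \<le> k"
      using len by (cases "k < w") (simp_all add: read_bit_def certificate_def del: upt_Suc)
  qed
qed

lemma read_bit_certificate:
  assumes "0 < q" "q < N" "k < w"
  shows "read_bit (certificate w N v) (w * q + 1 + k) = v q div 2 ^ (w - Suc k) mod 2"
proof -
  have "w * q + 1 + k < N * w + 1"
  proof -
    have "w * Suc q \<le> w * N"
      using assms(2) by (intro mult_le_mono2) simp
    then show ?thesis
      using assms(3) by (simp add: mult.commute)
  qed
  moreover have "w \<le> w * q"
    using assms(1) by simp
  then have "\<not> Suc (w * q + k) < w" "Suc (w * q + k) \<noteq> w"
    by linarith+
  ultimately show ?thesis
    using assms(3) by (simp add: read_bit_def certificate_def odd_iff_mod_2_eq_one del: upt_Suc)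
qed

lemma field_certificate:
  assumes "0 < q" "q < N" "v q < 2 ^ w"
  shows "field (certificate w N v) q = v q"
proof -
  let ?c = "certificate w N v"
  \<comment> \<open>Invariant of Horner's scheme: after \<open>m\<close> rounds the leading
    \<open>m\<close> of the \<open>w\<close> bits have been read.\<close>
  have "rec_nat 0 (\<lambda>k y. y + y + read_bit ?c (w * q + 1 + k)) m = v q div 2 ^ (w - m)" if "m \<le> w" for m
    using that
  proof (induction m)
    case 0
    then show ?case
      using assms(3) by simp
  next
    case (Suc m)
    define u where "u = v q div 2 ^ (w - Suc m)"
    have "w - m = Suc (w - Suc m)"
      using Suc.prems by simp
    then have "v q div 2 ^ (w - m) = u div 2"
      by (simp only: u_def power_Suc2 div_mult2_eq)
    moreover have "read_bit ?c (w * q + 1 + m) = u mod 2"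
      unfolding u_def using assms(1,2) Suc.prems by (intro read_bit_certificate) simp_all
    ultimately have "rec_nat 0 (\<lambda>k y. y + y + read_bit ?c (w * q + 1 + k)) (Suc m) =
        u div 2 + u div 2 + u mod 2"
      using Suc by simp
    also have "\<dots> = u"
      by presburger
    finally show ?case
      by (simp only: u_def)
  qed
  from this[of w] show ?thesis
    using assms(1,2) by (simp add: field_def read_number_def field_width_certificate)
qed

section \<open>Soundness and completeness of the verifier\<close>

lemma consistent_cong:
  assumes "A i j = A' i j" "A j i = A' j i"
    and "s i = s' i" "X i = X' i" "Y i = Y' i" "Z i = Z' i"
    and "s j = s' j" "X j = X' j" "Y j = Y' j" "Z j = Z' j"
  shows "consistent unit n A s X Y Z i j \<longleftrightarrow> consistent unit n A' s' X' Y' Z' i j"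
  unfolding consistent_def by (simp only: assms)

text \<open>Once the unit segments of a USEG graph are horizontal, the classes differ only in
  whether the vertical lengths are fixed too, so one Boolean carries both through the same
  proof.\<close>

definition grid_class :: "bool \<Rightarrow> 'a pair_pre_digraph \<Rightarrow> bool" where
  "grid_class unit = (if unit then unit_grid_intersection_graph else USEG_graph)"

lemma grid_class_iff:
  assumes "pair_graph G"
  shows "grid_class unit G \<longleftrightarrow> (\<exists>H V a b l. bipartition G H V \<and> grid_coordinates G H V a b l \<and>
    (\<forall>u\<in>H. l u = 1) \<and> (unit \<longrightarrow> (\<forall>v\<in>V. l v = 1)))"
proof -
  interpret pair_graph G
    by (rule assms)
  have "(u, v) \<in> parcs G \<Longrightarrow> (v, u) \<in> parcs G" for u v
    by (rule arcs_symmetric)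
  from USEG_graph_iff[of G, OF this] show ?thesis
    by (cases "unit") (simp_all add: grid_class_def unit_grid_intersection_graph_iff)
qed

lemma verifies_adjacency_code:
  assumes "pverts G = {..<n}"
  shows "verifies unit (adjacency_code G) c \<longleftrightarrow> (\<forall>i<n. \<forall>j<n.
    consistent unit n (\<lambda>i j. (i, j) \<in> parcs G) (\<lambda>i. field c (4 * i + 1)) (\<lambda>i. field c (4 * i + 2))
      (\<lambda>i. field c (4 * i + 3)) (\<lambda>i. field c (4 * i + 4)) i j)"
proof -
  have "consistent unit n (\<lambda>i j. read_bit (adjacency_code G) (n * i + j) = 1)
      (\<lambda>i. field c (4 * i + 1)) (\<lambda>i. field c (4 * i + 2)) (\<lambda>i. field c (4 * i + 3))
      (\<lambda>i. field c (4 * i + 4)) i j \<longleftrightarrow>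
    consistent unit n (\<lambda>i j. (i, j) \<in> parcs G) (\<lambda>i. field c (4 * i + 1)) (\<lambda>i. field c (4 * i + 2))
      (\<lambda>i. field c (4 * i + 3)) (\<lambda>i. field c (4 * i + 4)) i j" if "i < n" "j < n" for i j
    using that by (intro consistent_cong read_bit_adjacency_code[OF assms] refl)
  then show ?thesis
    by (simp add: verifies_def Let_def length_adjacency_code[OF assms] ceil_sqrt_square)
qed

text \<open>Membership in NP concerns all bit strings, so strings that encode no graph have to be
  rejected. The graph is rebuilt from the matrix; its symmetry and the absence of loops come from
  the pair test.\<close>

lemma verifies_imp_adjacency_code:
  assumes "verifies unit x c"
  obtains G n where "pair_graph G" "pverts G = {..<n}" "x = adjacency_code G"
proof -
  define n where "n = ceil_sqrt (length x)"
  define A where "A = (\<lambda>i j. read_bit x (n * i + j) = 1)"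
  define G where "G = \<lparr>pverts = {..<n}, parcs = {(i, j). i < n \<and> j < n \<and> A i j}\<rparr>"
  have "n * n = length x \<and> (\<forall>i<n. \<forall>j<n. consistent unit n A
      (\<lambda>i. field c (4 * i + 1)) (\<lambda>i. field c (4 * i + 2)) (\<lambda>i. field c (4 * i + 3))
      (\<lambda>i. field c (4 * i + 4)) i j)"
    using assms unfolding verifies_def Let_def n_def[symmetric] A_def[symmetric] .
  then have len: "length x = n * n" and con: "\<And>i j. i < n \<Longrightarrow> j < n \<Longrightarrow> consistent unit n A
      (\<lambda>i. field c (4 * i + 1)) (\<lambda>i. field c (4 * i + 2)) (\<lambda>i. field c (4 * i + 3))
      (\<lambda>i. field c (4 * i + 4)) i j"
    by simp_all
  have "finite (parcs G)"
    by (rule finite_subset[of _ "{..<n} \<times> {..<n}"]) (auto simp: G_def)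
  moreover have "A i j \<longleftrightarrow> A j i" if "i < n" "j < n" for i j
    using con[OF that] by (rule consistentD(1))
  \<comment> \<open>On the diagonal, an arc would make \<open>s i = 0\<close> equivalent to its own
    negation.\<close>
  moreover have "\<not> A i i" if "i < n" for i
    using consistentD(2)[OF con[OF that that]] by blast
  ultimately have "pair_graph G"
    by unfold_locales (auto simp: G_def symmetric_def sym_def)
  moreover have "pverts G = {..<n}"
    by (simp add: G_def)
  moreover have "x = adjacency_code G"
    using len by (intro adjacency_code_eqI[of G n]) (simp_all add: G_def A_def)
  ultimately show thesis
    by (rule that)
qed

lemma verifies_sound:
  assumes "verifies unit (adjacency_code G) c" "pair_graph G" "pverts G = {..<n}"
  shows "grid_class unit G"
proof -
  interpret pair_graph G
    by (rule assms)
  have arcs: "parcs G \<subseteq> {..<n} \<times> {..<n}"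
    using in_arcsD1 in_arcsD2 assms(3) by auto
  obtain H V a b l where "bipartition G H V" "grid_coordinates G H V a b l"
    "\<forall>u\<in>H. l u = 1" "unit \<longrightarrow> (\<forall>v\<in>V. l v = 1)"
    by (rule consistent_imp_coordinates[OF assms(3) arcs refl
          assms(1)[unfolded verifies_adjacency_code[OF assms(3)], rule_format]])
  then show ?thesis
    unfolding grid_class_iff[OF assms(2)] by blast
qed

definition certificate_size :: "nat \<Rightarrow> nat" where
  "certificate_size n = (4 * n + 1) * (2 * floor_log n + 6) + 1"

lemma verifies_complete:
  assumes "grid_class unit G" "pair_graph G" "pverts G = {..<n}"
  shows "\<exists>c. length c \<le> certificate_size n \<and> verifies unit (adjacency_code G) c"
proof -
  interpret pair_graph G
    by (rule assms)
  obtain H V a b l where rep: "bipartition G H V" "grid_coordinates G H V a b l"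
    "\<forall>u\<in>H. l u = 1" "unit \<longrightarrow> (\<forall>v\<in>V. l v = 1)"
    using assms(1) unfolding grid_class_iff[OF assms(2)] by blast
  obtain s X Y Z where bound: "\<forall>i<n. s i \<le> 12 * (n * n) \<and> X i \<le> 12 * (n * n) \<and>
      Y i \<le> 12 * (n * n) \<and> Z i \<le> 12 * (n * n)"
    and con: "\<forall>i<n. \<forall>j<n. consistent unit n (\<lambda>i j. (i, j) \<in> parcs G) s X Y Z i j"
    by (rule coordinates_imp_consistent[OF assms(3) arcs_symmetric refl rep])
  define w where "w = 2 * floor_log n + 6"
  \<comment> \<open>The number \<open>4 * i + 4\<close> has residue 0 and quotient
    \<open>i + 1\<close>, hence the \<open>- 1\<close> in the last case.\<close>
  define v where "v q = (if q mod 4 = 1 then s (q div 4) else if q mod 4 = 2 then X (q div 4)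
    else if q mod 4 = 3 then Y (q div 4) else Z (q div 4 - 1))" for q
  define c where "c = certificate w (4 * n + 1) v"
  have small: "k < 2 ^ w" if "k \<le> 12 * (n * n)" for k
  proof -
    \<comment> \<open>With \<open>n < 2 * m\<close>, the bound \<open>12 * (n * n)\<close> is below
      \<open>48 * (m * m)\<close>, and \<open>2 ^ w\<close> is \<open>64 * (m * m)\<close>; the
      summand 6 in the width supplies the factor 64.\<close>
    define m :: nat where "m = 2 ^ floor_log n"
    have "n * n < (2 * m) * (2 * m)"
      using floor_log_exp2_gt[of n] unfolding m_def by (intro mult_strict_mono') simp_all
    then have "n * n < 4 * (m * m)"
      by simp
    moreover have "2 ^ w = m * m * 2 ^ 6"
      by (simp only: w_def m_def mult_2 power_add)
    then have "2 ^ w = 64 * (m * m)"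
      by simp
    ultimately show ?thesis
      using that by linarith
  qed
  have "(4 * i + 1) mod 4 = 1" "(4 * i + 2) mod 4 = 2" "(4 * i + 3) mod 4 = 3" "(4 * i + 4) mod 4 = 0"
    "(4 * i + 1) div 4 = i" "(4 * i + 2) div 4 = i" "(4 * i + 3) div 4 = i" "(4 * i + 4) div 4 - 1 = i"
    for i :: nat
    by presburger+
  note divmod = this
  have v: "v (4 * i + 1) = s i" "v (4 * i + 2) = X i" "v (4 * i + 3) = Y i" "v (4 * i + 4) = Z i" for i
    unfolding v_def divmod by simp_all
  have c: "field c q = v q" if "0 < q" "q < 4 * n + 1" "v q \<le> 12 * (n * n)" for q
    unfolding c_def using that small by (intro field_certificate) simp_all
  have fields: "field c (4 * i + 1) = s i" "field c (4 * i + 2) = X i"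
    "field c (4 * i + 3) = Y i" "field c (4 * i + 4) = Z i" if "i < n" for i
    using c[of "4 * i + 1"] c[of "4 * i + 2"] c[of "4 * i + 3"] c[of "4 * i + 4"] that bound
    unfolding v by simp_all
  have "consistent unit n (\<lambda>i j. (i, j) \<in> parcs G) (\<lambda>i. field c (4 * i + 1))
      (\<lambda>i. field c (4 * i + 2)) (\<lambda>i. field c (4 * i + 3)) (\<lambda>i. field c (4 * i + 4)) i j"
    if "i < n" "j < n" for i j
  proof -
    have "consistent unit n (\<lambda>i j. (i, j) \<in> parcs G) s X Y Z i j"
      using con that by blast
    moreover have "consistent unit n (\<lambda>i j. (i, j) \<in> parcs G) (\<lambda>i. field c (4 * i + 1))
        (\<lambda>i. field c (4 * i + 2)) (\<lambda>i. field c (4 * i + 3)) (\<lambda>i. field c (4 * i + 4)) i j \<longleftrightarrow>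
      consistent unit n (\<lambda>i j. (i, j) \<in> parcs G) s X Y Z i j"
      by (rule consistent_cong) (simp_all only: fields that)
    ultimately show ?thesis
      by blast
  qed
  then have "verifies unit (adjacency_code G) c"
    unfolding verifies_adjacency_code[OF assms(3)] by blast
  moreover have "length c \<le> certificate_size n"
    by (simp add: c_def length_certificate certificate_size_def w_def)
  ultimately show ?thesis
    by blast
qed

lemma certificate_size_bigo: "(\<lambda>n. real (certificate_size n)) \<in> O(\<lambda>n. real n * ln (real n))"
proof (rule bigoI)
  \<comment> \<open>For \<open>n \<ge> 2\<close>, \<open>ln 2 \<ge> 1 / 2\<close> gives
    \<open>2 * floor_log n \<le> 4 * ln n\<close> and \<open>6 \<le> 12 * ln n\<close>. With
    \<open>4 * n + 1 \<le> 5 * n\<close> the product is at most 80 times \<open>n * ln n\<close>,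
    and the final 1 costs another 2.\<close>
  show "eventually (\<lambda>n. norm (real (certificate_size n)) \<le> 82 * norm (real n * ln (real n))) at_top"
    using eventually_ge_at_top[of 2]
  proof eventually_elim
    case (elim n)
    have "ln 2 \<le> ln (real n)" and ln2: "1 / 2 \<le> ln (2 :: real)"
      using elim ln_2_less_1 ln2_ge_two_thirds by simp_all
    then have ln1: "1 \<le> 2 * ln (real n)"
      by linarith
    have "2 ^ floor_log n \<le> n"
      using elim by (intro floor_log_exp2_le) simp
    then have "real (2 ^ floor_log n) \<le> real n"
      by (simp only: of_nat_le_iff)
    then have "ln (2 ^ floor_log n) \<le> ln (real n)"
      using elim by (subst ln_le_cancel_iff) simp_all
    then have "real (floor_log n) * ln 2 \<le> ln (real n)"
      by (simp add: ln_realpow)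
    moreover have "real (floor_log n) * (1 / 2) \<le> real (floor_log n) * ln 2"
      using ln2 by (intro mult_left_mono) simp_all
    ultimately have "2 * real (floor_log n) + 6 \<le> 16 * ln (real n)"
      using ln1 by linarith
    moreover have "4 * real n + 1 \<le> 5 * real n"
      using elim by simp
    ultimately have "(4 * real n + 1) * (2 * real (floor_log n) + 6) \<le> (5 * real n) * (16 * ln (real n))"
      by (intro mult_mono) simp_all
    moreover have "1 * 1 \<le> real n * (2 * ln (real n))"
      using elim ln1 by (intro mult_mono) simp_all
    ultimately have "(4 * real n + 1) * (2 * real (floor_log n) + 6) + 1 \<le> 82 * (real n * ln (real n))"
      by simp
    moreover have "real (certificate_size n) = (4 * real n + 1) * (2 * real (floor_log n) + 6) + 1"
      unfolding certificate_size_def by (simp add: algebra_simps)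
    moreover have "0 \<le> real n * ln (real n)"
      using ln1 by (intro mult_nonneg_nonneg) simp_all
    ultimately show ?case
      by (simp only: real_norm_def abs_of_nat abs_of_nonneg)
  qed
qed

text \<open>The input is a matrix of \<open>n * n\<close> bits, so the bound that NP asks for must
  be a polynomial in that length.\<close>

lemma certificate_size_poly: "\<exists>q :: nat poly. \<forall>n. certificate_size n \<le> poly q (n * n)"
proof -
  have "poly_bounded (\<lambda>N. (4 * N + 1) * (2 * N + 6) + 1)"
    by (intro poly_bounded_intros)
  then obtain q :: "nat poly" where q: "\<And>N. (4 * N + 1) * (2 * N + 6) + 1 \<le> poly q N"
    unfolding poly_bounded_def by blast
  have "certificate_size n \<le> poly q (n * n)" for n
  proof -
    have "floor_log n \<le> n"
    proof (cases "n = 0")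
      case False
      then show ?thesis
        using floor_log_exp2_le[of n] less_exp[of "floor_log n"] by linarith
    qed simp
    moreover have "n \<le> n * n"
      by (rule le_square)
    ultimately have "certificate_size n \<le> (4 * (n * n) + 1) * (2 * (n * n) + 6) + 1"
      unfolding certificate_size_def by (intro add_mono mult_le_mono) linarith+
    then show ?thesis
      using q le_trans by blast
  qed
  then show ?thesis
    by blast
qed

lemma grid_class_verifier:
  obtains P where "certificate_verifier P (grid_class unit) certificate_size"
    "recognition_problem (grid_class unit) \<in> NP"
proof -
  obtain P where P: "polynomial_time P" "\<And>x c. accepts P x c \<longleftrightarrow> verifies unit x c"
    using decidable_verifier[OF decidable_verifies] by blast
  obtain q :: "nat poly" where q: "\<And>n. certificate_size n \<le> poly q (n * n)"
    using certificate_size_poly by blast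
  show thesis
  proof
    show "certificate_verifier P (grid_class unit) certificate_size"
      unfolding certificate_verifier_def P(2)
    proof (intro conjI allI impI P(1) notI)
      fix n and G :: "nat pair_pre_digraph"
      assume "pair_graph G \<and> pverts G = {..<n}"
      then have G: "pair_graph G" "pverts G = {..<n}"
        by simp_all
      show "\<exists>c. length c \<le> certificate_size n \<and> verifies unit (adjacency_code G) c"
        if "grid_class unit G"
        using that G by (rule verifies_complete)
      show False if "\<not> grid_class unit G" "verifies unit (adjacency_code G) c" for c
        using that(1) verifies_sound[OF that(2) G] by (rule notE)
    qed
    have "x \<in> recognition_problem (grid_class unit) \<longleftrightarrow>
        (\<exists>c. length c \<le> poly q (length x) \<and> accepts P x c)" for x
    proof
      assume "x \<in> recognition_problem (grid_class unit)"
      then obtain G where G: "x = adjacency_code G" "pair_graph G" "pverts G = {..<card (pverts G)}"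
        "grid_class unit G"
        unfolding recognition_problem_def by blast
      obtain c where "length c \<le> certificate_size (card (pverts G))" "verifies unit x c"
        using verifies_complete[OF G(4,2,3)] G(1) by blast
      then show "\<exists>c. length c \<le> poly q (length x) \<and> accepts P x c"
        using q[of "card (pverts G)"] length_adjacency_code[OF G(3)] P(2) G(1) by (metis le_trans)
    next
      assume "\<exists>c. length c \<le> poly q (length x) \<and> accepts P x c"
      then obtain c where c: "verifies unit x c"
        using P(2) by blast
      obtain G n where G: "pair_graph G" "pverts G = {..<n}" "x = adjacency_code G"
        by (rule verifies_imp_adjacency_code[OF c])
      then have "grid_class unit G"
        using verifies_sound c by blast
      moreover have "pverts G = {..<card (pverts G)}"
        by (simp add: G(2))
      ultimately show "x \<in> recognition_problem (grid_class unit)"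
        unfolding recognition_problem_def using G(1,3) by blast
    qed
    then show "recognition_problem (grid_class unit) \<in> NP"
      unfolding NP_def using P(1) by blast
  qed
qed

theorem theorem4:
  shows "recognition_problem unit_grid_intersection_graph \<in> NP \<and>
         recognition_problem USEG_graph \<in> NP \<and>
         (\<exists>P b. certificate_verifier P unit_grid_intersection_graph b \<and>
            (\<lambda>n. real (b n)) \<in> O(\<lambda>n. real n * ln (real n))) \<and>
         (\<exists>P b. certificate_verifier P USEG_graph b \<and>
            (\<lambda>n. real (b n)) \<in> O(\<lambda>n. real n * ln (real n)))"
proof -
  have unit: "grid_class True = unit_grid_intersection_graph"
    and USEG: "grid_class False = USEG_graph"
    by (simp_all add: grid_class_def)
  obtain P where "certificate_verifier P unit_grid_intersection_graph certificate_size"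
    "recognition_problem unit_grid_intersection_graph \<in> NP"
    by (rule grid_class_verifier[of True, unfolded unit])
  moreover obtain Q where "certificate_verifier Q USEG_graph certificate_size"
    "recognition_problem USEG_graph \<in> NP"
    by (rule grid_class_verifier[of False, unfolded USEG])
  ultimately show ?thesis
    using certificate_size_bigo by blast
qed

end
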